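(* Let $d>1$, let $(Q,\mathcal F_Q,\mathbb M)$ be a standard Borel space with a nonatomic probability measure, and let $(\mathsf E'_n)_{n\ge1}$ be a complete orthonormal system of $L^2(Q,\mathbb M;\mathbb R)$. Let $\Sigma_n\in\mathbb R^{d\times d}$, $n\ge1$, be symmetric positive definite matrices with $$0<\alpha_n^2\le\Sigma_nv\cdot v\le\beta_n^2\quad\text{for every }v\in\mathbb R^d,\ |v|=1;\qquad\sum_{n=1}^\infty\beta_n^2<\infty,$$ let $\xi_n\sim N(0,\Sigma_n)$ be independent centered Gaussian random variables in $\mathbb R^d$ defined on a probability space $(\Omega,\mathcal F,\mathbb P)$, and let $\mathfrak g$ be the law in $\mathcal H:=L^2(Q,\mathbb M;\mathbb R^d)$ of the random vector $\boldsymbol\xi=\sum_n\xi_n\mathsf E'_n$. Set $$\alpha^2(q_1,q_2):=\sum_n\alpha_n^2\big(\mathsf E'_n(q_1)-\mathsf E'_n(q_2)\big)^2 .$$ If $$\int_{Q\times Q}\frac1{\alpha^d(q_1,q_2)}\,d\mathbb M(q_1)\,d\mathbb M(q_2)<\infty,$$ then $\mathtt G=\iota_\sharp\mathfrak g\in\mathcal P_2(\mathcal P_2(\mathbb R^d))$ is super-G-regular, where $\iota(X):=X_\sharp\mathbb M$.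
   Context: $\mathcal P_2(\mathbb R^d)$: Borel probability measures on $\mathbb R^d$ with finite quadratic moment, with 2-Wasserstein metric; $\mathcal P_2(\mathcal P_2(\mathbb R^d))$: Borel probability measures on it with finite quadratic moment. The series $\sum_n\xi_n\mathsf E'_n$ converges in $L^2(\Omega,\mathbb P;\mathcal H)$. A Gaussian measure on a separable Hilbert space is nondegenerate if every nonzero continuous linear functional has a Gaussian law with positive variance; a Borel subset of $\mathcal H$ is Gaussian-null if it is negligible for every nondegenerate Gaussian measure on $\mathcal H$. d.c. hypersurface of $\mathbb R^d$: a set $\{x+(f(x)-g(x))v:x\in v^\perp\}$ with $v\neq0$ and $f,g:v^\perp\to\mathbb R$ Lipschitz convex. $\mathcal P_2^r(\mathbb R^d)$: measures in $\mathcal P_2(\mathbb R^d)$ vanishing on all d.c. hypersurfaces. $\mathtt M\in\mathcal P_2(\mathcal P_2(\mathbb R^d))$ is super-G-regular if (i) $\mathtt M$ is concentrated on $\mathcal P_2^r(\mathbb R^d)$ and (ii) $\mathtt M(B)=0$ for every Borel $B\subset\mathcal P_2(\mathbb R^d)$ such that $\iota^{-1}(B)$ is Gaussian-null in $\mathcal H$. *)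

theory Defs
  imports "HOL-Probability.Probability"
begin

section \<open>Measurable spaces\<close>

text \<open>The Borel $\sigma$-algebra of the metric \<open>d\<close> on the carrier \<open>S\<close>. Openness is written
  out as in the library's abstract metric spaces, see \<open>metric_borel_eq\<close>.\<close>

definition metric_borel :: "'a set \<Rightarrow> ('a \<Rightarrow> 'a \<Rightarrow> real) \<Rightarrow> 'a measure" where
  "metric_borel S d = sigma S {U. U \<subseteq> S \<and> (\<forall>x\<in>U. \<exists>r>0. \<forall>y\<in>S. d x y < r \<longrightarrow> y \<in> U)}"

lemma metric_borel_eq:
  assumes "Metric_space S d"
  shows "metric_borel S d = sigma S {U. openin (Metric_space.mtopology S d) U}"
proof -
  interpret Metric_space S d by fact
  have "openin mtopology U \<longleftrightarrow> U \<subseteq> S \<and> (\<forall>x\<in>U. \<exists>r>0. \<forall>y\<in>S. d x y < r \<longrightarrow> y \<in> U)" for U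
    unfolding openin_mtopology mball_def by blast
  then show ?thesis
    by (simp add: metric_borel_def)
qed

definition standard_borel_space :: "'q measure \<Rightarrow> bool" where
  "standard_borel_space Q \<longleftrightarrow>
    (\<exists>T. completely_metrizable_space T \<and> second_countable T \<and> topspace T = space Q \<and>
         sets Q = sigma_sets (space Q) {U. openin T U})"

definition nonatomic :: "'q measure \<Rightarrow> bool" where
  "nonatomic Q \<longleftrightarrow>
    (\<forall>A\<in>sets Q. 0 < emeasure Q A \<longrightarrow>
      (\<exists>B\<in>sets Q. B \<subseteq> A \<and> 0 < emeasure Q B \<and> emeasure Q B < emeasure Q A))"

section \<open>The Wasserstein space\<close>

definition P2 :: "'v::euclidean_space measure set" where
  "P2 = {\<mu>. sets \<mu> = sets borel \<and> prob_space \<mu> \<and> (\<integral>\<^sup>+ x. ennreal ((norm x)\<^sup>2) \<partial>\<mu>) < \<infinity>}"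

definition couplings ::
  "'v::euclidean_space measure \<Rightarrow> 'v measure \<Rightarrow> ('v \<times> 'v) measure set" where
  "couplings \<mu> \<nu> = {\<gamma>. sets \<gamma> = sets (borel \<Otimes>\<^sub>M borel) \<and>
                      distr \<gamma> borel fst = \<mu> \<and> distr \<gamma> borel snd = \<nu>}"

definition W2 :: "'v::euclidean_space measure \<Rightarrow> 'v measure \<Rightarrow> real" where
  "W2 \<mu> \<nu> =
    sqrt (enn2real (INF \<gamma>\<in>couplings \<mu> \<nu>. \<integral>\<^sup>+ z. ennreal ((dist (fst z) (snd z))\<^sup>2) \<partial>\<gamma>))"

definition P2_borel :: "'v::euclidean_space measure measure" where
  "P2_borel = metric_borel P2 W2"

text \<open>As usual in a metric space, a finite quadratic moment is one with respect to some
  (equivalently, every) base point.\<close>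

definition P2P2 :: "'v::euclidean_space measure measure set" where
  "P2P2 = {M. sets M = sets P2_borel \<and> prob_space M \<and>
              (\<exists>\<nu>\<in>P2. (\<integral>\<^sup>+ \<mu>. ennreal ((W2 \<mu> \<nu>)\<^sup>2) \<partial>M) < \<infinity>)}"

definition dc_hypersurface :: "'v::euclidean_space set \<Rightarrow> bool" where
  "dc_hypersurface A \<longleftrightarrow>
    (\<exists>v f g. v \<noteq> 0 \<and> convex_on (orthogonal_comp {v}) f \<and> convex_on (orthogonal_comp {v}) g \<and>
       (\<exists>L. L-lipschitz_on (orthogonal_comp {v}) f) \<and>
       (\<exists>L. L-lipschitz_on (orthogonal_comp {v}) g) \<and>
       A = (\<lambda>x. x + (f x - g x) *\<^sub>R v) ` orthogonal_comp {v})"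

definition P2r :: "'v::euclidean_space measure set" where
  "P2r = {\<mu>\<in>P2. \<forall>A. dc_hypersurface A \<longrightarrow> A \<in> null_sets \<mu>}"

section \<open>The Hilbert space $L^2$\<close>

text \<open>Elements of \<open>L2 Q\<close> are classes of square integrable functions modulo equality almost
  everywhere. The operations below are defined through arbitrary representatives.\<close>

definition L2_fun :: "'q measure \<Rightarrow> ('q \<Rightarrow> 'v::euclidean_space) set" where
  "L2_fun Q = {f \<in> borel_measurable Q. integrable Q (\<lambda>q. (norm (f q))\<^sup>2)}"

definition L2_class :: "'q measure \<Rightarrow> ('q \<Rightarrow> 'v::euclidean_space) \<Rightarrow> ('q \<Rightarrow> 'v) set" where
  "L2_class Q f = {g \<in> L2_fun Q. AE q in Q. g q = f q}"

definition L2 :: "'q measure \<Rightarrow> ('q \<Rightarrow> 'v::euclidean_space) set set" where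
  "L2 Q = L2_class Q ` L2_fun Q"

definition L2_rep :: "('q \<Rightarrow> 'v::euclidean_space) set \<Rightarrow> 'q \<Rightarrow> 'v" where
  "L2_rep X = (SOME f. f \<in> X)"

definition L2_add ::
  "'q measure \<Rightarrow> ('q \<Rightarrow> 'v::euclidean_space) set \<Rightarrow> ('q \<Rightarrow> 'v) set \<Rightarrow> ('q \<Rightarrow> 'v) set" where
  "L2_add Q X Y = L2_class Q (\<lambda>q. L2_rep X q + L2_rep Y q)"

definition L2_scale ::
  "'q measure \<Rightarrow> real \<Rightarrow> ('q \<Rightarrow> 'v::euclidean_space) set \<Rightarrow> ('q \<Rightarrow> 'v) set" where
  "L2_scale Q c X = L2_class Q (\<lambda>q. c *\<^sub>R L2_rep X q)"

definition L2_norm :: "'q measure \<Rightarrow> ('q \<Rightarrow> 'v::euclidean_space) set \<Rightarrow> real" where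
  "L2_norm Q X = sqrt (\<integral>q. (norm (L2_rep X q))\<^sup>2 \<partial>Q)"

definition L2_dist ::
  "'q measure \<Rightarrow> ('q \<Rightarrow> 'v::euclidean_space) set \<Rightarrow> ('q \<Rightarrow> 'v) set \<Rightarrow> real" where
  "L2_dist Q X Y = sqrt (\<integral>q. (norm (L2_rep X q - L2_rep Y q))\<^sup>2 \<partial>Q)"

definition L2_borel :: "'q measure \<Rightarrow> ('q \<Rightarrow> 'v::euclidean_space) set measure" where
  "L2_borel Q = metric_borel (L2 Q) (L2_dist Q)"

definition L2_functional ::
  "'q measure \<Rightarrow> (('q \<Rightarrow> 'v::euclidean_space) set \<Rightarrow> real) \<Rightarrow> bool" where
  "L2_functional Q l \<longleftrightarrow>
    (\<forall>X\<in>L2 Q. \<forall>Y\<in>L2 Q. l (L2_add Q X Y) = l X + l Y) \<and>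
    (\<forall>c. \<forall>X\<in>L2 Q. l (L2_scale Q c X) = c * l X) \<and>
    (\<exists>C. \<forall>X\<in>L2 Q. \<bar>l X\<bar> \<le> C * L2_norm Q X)"

text \<open>The \<open>E n\<close> are representatives of the elements of the system; completeness means that
  their finite linear combinations are dense.\<close>

definition complete_orthonormal_system :: "'q measure \<Rightarrow> (nat \<Rightarrow> 'q \<Rightarrow> real) \<Rightarrow> bool" where
  "complete_orthonormal_system Q E \<longleftrightarrow>
    (\<forall>n. E n \<in> L2_fun Q) \<and>
    (\<forall>m n. (\<integral>q. E m q * E n q \<partial>Q) = (if m = n then 1 else 0)) \<and>
    (\<forall>f\<in>L2_fun Q. \<forall>e>0. \<exists>N c. (\<integral>q. (f q - (\<Sum>n<N. c n * E n q))\<^sup>2 \<partial>Q) < e)"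

section \<open>Gaussian measures and regularity\<close>

text \<open>The mean \<open>m\<close> is arbitrary: Gaussian measures need not be centered.\<close>

definition nondegenerate_gaussian ::
  "'q measure \<Rightarrow> ('q \<Rightarrow> 'v::euclidean_space) set measure \<Rightarrow> bool" where
  "nondegenerate_gaussian Q \<gamma> \<longleftrightarrow>
    sets \<gamma> = sets (L2_borel Q) \<and> prob_space \<gamma> \<and>
    (\<forall>l. L2_functional Q l \<and> (\<exists>X\<in>L2 Q. l X \<noteq> 0) \<longrightarrow>
      (\<exists>m \<sigma>. 0 < \<sigma> \<and> distributed \<gamma> lborel l (normal_density m \<sigma>)))"

definition gaussian_null :: "'q measure \<Rightarrow> ('q \<Rightarrow> 'v::euclidean_space) set set \<Rightarrow> bool" where
  "gaussian_null Q B \<longleftrightarrow>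
    B \<in> sets (L2_borel Q) \<and> (\<forall>\<gamma>. nondegenerate_gaussian Q \<gamma> \<longrightarrow> emeasure \<gamma> B = 0)"

definition iota :: "'q measure \<Rightarrow> ('q \<Rightarrow> 'v::euclidean_space) set \<Rightarrow> 'v measure" where
  "iota Q X = distr Q borel (L2_rep X)"

definition super_G_regular ::
  "'q measure \<Rightarrow> 'v::euclidean_space measure measure \<Rightarrow> bool" where
  "super_G_regular Q M \<longleftrightarrow>
    M \<in> P2P2 \<and> (AE \<mu> in M. \<mu> \<in> P2r) \<and>
    (\<forall>B\<in>sets P2_borel. gaussian_null Q {X\<in>L2 Q. iota Q X \<in> B} \<longrightarrow> emeasure M B = 0)"

section \<open>Gaussian random series\<close>

definition sym_pos_def :: "real^'d^'d \<Rightarrow> bool" where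
  "sym_pos_def S \<longleftrightarrow> transpose S = S \<and> (\<forall>v. v \<noteq> 0 \<longrightarrow> 0 < (S *v v) \<bullet> v)"

text \<open>The law \<open>N(0,S)\<close>, for positive definite \<open>S\<close>: as for Gaussian measures on Hilbert spaces,
  it is given by the laws \<open>N(0, Sv \<bullet> v)\<close> of the linear functionals. The parameter of
  \<open>normal_density\<close> is the standard deviation.\<close>

definition centered_normal :: "'w measure \<Rightarrow> ('w \<Rightarrow> real^'d) \<Rightarrow> real^'d^'d \<Rightarrow> bool" where
  "centered_normal P X S \<longleftrightarrow>
    X \<in> borel_measurable P \<and>
    (\<forall>v. v \<noteq> 0 \<longrightarrow>
      distributed P lborel (\<lambda>\<omega>. X \<omega> \<bullet> v) (normal_density 0 (sqrt ((S *v v) \<bullet> v))))"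

text \<open>\<open>\<Xi>\<close> is (a version of) the sum of the series of the \<open>\<xi> n *\<^sub>R E n\<close> in
  $L^2(\Omega,P;L^2(Q))$.\<close>

definition L2_series_sum ::
  "'w measure \<Rightarrow> 'q measure \<Rightarrow> (nat \<Rightarrow> 'q \<Rightarrow> real) \<Rightarrow> (nat \<Rightarrow> 'w \<Rightarrow> 'v::euclidean_space)
    \<Rightarrow> ('w \<Rightarrow> ('q \<Rightarrow> 'v) set) \<Rightarrow> bool" where
  "L2_series_sum P Q E \<xi> \<Xi> \<longleftrightarrow>
    \<Xi> \<in> measurable P (L2_borel Q) \<and>
    (\<lambda>N. \<integral>\<^sup>+ \<omega>. ennreal ((L2_dist Q (\<Xi> \<omega>) (L2_class Q (\<lambda>q. \<Sum>n<N. E n q *\<^sub>R \<xi> n \<omega>)))\<^sup>2) \<partial>P)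
      \<longlonglongrightarrow> 0"

definition ennreal_sqrt :: "ennreal \<Rightarrow> ennreal" where
  "ennreal_sqrt x = (if x = \<infinity> then \<infinity> else ennreal (sqrt (enn2real x)))"

definition series_alpha_sq ::
  "(nat \<Rightarrow> real) \<Rightarrow> (nat \<Rightarrow> 'q \<Rightarrow> real) \<Rightarrow> 'q \<Rightarrow> 'q \<Rightarrow> ennreal" where
  "series_alpha_sq \<alpha> E q1 q2 = (\<Sum>n. ennreal ((\<alpha> n)\<^sup>2 * (E n q1 - E n q2)\<^sup>2))"

end

theory Submission
  imports Defs
begin

text \<open>The map \<open>\<iota>\<close> is 1-Lipschitz, so the image law lies in the Wasserstein space over the
  Wasserstein space. The law of the series is a nondegenerate Gaussian: a functional of the series
  is an \<open>L\<^sup>2\<close> limit of sums of independent centered normal variables, and it cannot be degenerate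
  unless the functional vanishes on the complete system. This gives condition (ii) at once.

  For condition (i), almost every \<open>\<iota>(\<xi>)\<close> even vanishes on all Lebesgue null sets. Let \<open>J\<^sub>r(\<mu>)\<close> be the
  \<open>\<mu> \<otimes> \<mu>\<close>-measure of the pairs at distance less than \<open>2r\<close>. By Cauchy--Schwarz applied to the
  function \<open>x \<mapsto> \<mu>(B(x,r))\<close>, a measure with \<open>liminf J\<^sub>r(\<mu>) / r\<^sup>d < \<infinity>\<close> vanishes on null sets. The
  difference \<open>\<xi>(q\<^sub>1) - \<xi>(q\<^sub>2)\<close> is Gaussian with covariance at least \<open>\<alpha>\<^sup>2(q\<^sub>1,q\<^sub>2)\<close>, so it is smaller than
  \<open>r\<close> with probability at most \<open>C r\<^sup>d / \<alpha>\<^sup>d\<close>; integrating over \<open>Q \<times> Q\<close> bounds the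
  expectation of \<open>J\<^sub>r / r\<^sup>d\<close>, and Fatou's lemma concludes. As \<open>\<xi>\<close> is only an
  \<open>L\<^sup>2\<close> limit, the pairs are counted for partial sums, at the cost of an error term which
  vanishes by Markov's inequality.\<close>

section \<open>Integrals of nonmeasurable functions\<close>

text \<open>The values of \<open>\<Xi>\<close> are classes, so \<open>\<Xi> \<omega>\<close> has no
  value at a point of \<open>Q\<close>; pointwise computations and the exchange of the integrals
  over \<open>P\<close> and \<open>Q\<close> take place on \<open>partial_sum\<close>. The transfer
  to \<open>\<Xi>\<close> costs a multiple of the mean square error divided by the square of the
  radius, which blows up for small radii. Hence the number of terms tends to infinity at a fixed
  radius, and only then does the radius tend to 0. The exponent d balances two powers: a ball of
  radius r has volume of order r^d, and the small-ball probability has the same order, so J_r / r^d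
  is bounded in mean once \<alpha>^(-d) is integrable. Such a bound controls only a liminf almost
  surely. This suffices, because a null set can be tested with radii selected separately for each
  measure. The hypersurfaces form an uncountable family, whose exceptional events cannot simply be
  united. Finiteness of the liminf is a single event, on which all Lebesgue null sets, and with them
  all hypersurfaces, are handled at once.\<close>

text \<open>The integral of a nonmeasurable function is its lower integral, for which only some of the usual
  rules survive. They spare us measurability proofs for distances between random elements.\<close>

lemma nn_integral_le_add_nonmeasurable:
  fixes F G D :: "'a \<Rightarrow> ennreal"
  assumes [measurable]: "G \<in> borel_measurable M"
    and fin: "\<And>x. x \<in> space M \<Longrightarrow> G x < \<infinity>"
    and "c > 0"
    and le: "\<And>x. x \<in> space M \<Longrightarrow> F x \<le> G x + ennreal c * D x"
  shows "(\<integral>\<^sup>+x. F x \<partial>M) \<le> (\<integral>\<^sup>+x. G x \<partial>M) + ennreal c * (\<integral>\<^sup>+x. D x \<partial>M)"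
proof -
  \<comment> \<open>The integral of \<open>F\<close> is the supremum over simple
    \<open>s \<le> F\<close>. Truncated subtraction makes \<open>(s x - G x) / ennreal c\<close> a
    measurable minorant of \<open>D\<close>; so \<open>D\<close> enters only through monotonicity,
    and additivity is applied to measurable functions alone.\<close>
  have "integral\<^sup>S M s \<le> (\<integral>\<^sup>+x. G x \<partial>M) + ennreal c * (\<integral>\<^sup>+x. D x \<partial>M)"
    if s: "simple_function M s" "s \<le> F" for s
  proof -
    have [measurable]: "s \<in> borel_measurable M"
      by (rule borel_measurable_simple_function[OF s(1)])
    have "integral\<^sup>S M s = (\<integral>\<^sup>+x. s x \<partial>M)"
      by (rule nn_integral_eq_simple_integral[symmetric, OF s(1)])
    also have "\<dots> \<le> (\<integral>\<^sup>+x. G x + (s x - G x) \<partial>M)"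
    proof (rule nn_integral_mono)
      show "s x \<le> G x + (s x - G x)" for x
        by (cases "s x \<le> G x") (auto simp: add_increasing2 simp flip: ennreal_ineq_diff_add)
    qed
    also have "\<dots> = (\<integral>\<^sup>+x. G x \<partial>M) + (\<integral>\<^sup>+x. s x - G x \<partial>M)"
      by (intro nn_integral_add) auto
    also have "(\<integral>\<^sup>+x. s x - G x \<partial>M) = (\<integral>\<^sup>+x. ennreal c * ((s x - G x) / ennreal c) \<partial>M)"
      using \<open>c > 0\<close> by (intro nn_integral_cong) (simp add: ennreal_times_divide ennreal_mult_divide_eq mult.commute[of "ennreal c"])
    also have "\<dots> = ennreal c * (\<integral>\<^sup>+x. (s x - G x) / ennreal c \<partial>M)"
      by (rule nn_integral_cmult) measurable
    also have "(\<integral>\<^sup>+x. (s x - G x) / ennreal c \<partial>M) \<le> (\<integral>\<^sup>+x. D x \<partial>M)"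
    proof (rule nn_integral_mono)
      fix x assume x: "x \<in> space M"
      have "s x \<le> G x + ennreal c * D x"
        using le[OF x] s(2) by (auto simp: le_fun_def intro: order_trans)
      with fin[OF x] have "s x - G x \<le> ennreal c * D x"
        by (force simp: ennreal_minus_le_iff)
      then have "(s x - G x) / ennreal c \<le> ennreal c * D x / ennreal c"
        by (rule divide_right_mono_ennreal)
      with \<open>c > 0\<close> show "(s x - G x) / ennreal c \<le> D x"
        by (simp add: ennreal_mult_divide_eq mult.commute[of "ennreal c"])
    qed
    finally show ?thesis by (simp add: add_left_mono mult_left_mono)
  qed
  then show ?thesis
    unfolding nn_integral_def[of M F] by (intro SUP_least) auto
qed

text \<open>Equality may fail if \<open>f\<close> is not measurable: simple minorants of
  \<open>f\<close> pull back along \<open>T\<close>, but minorants of the composition need not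
  factor through \<open>T\<close>. The surviving inequality is the one that carries finiteness of a
  moment over to an image measure.\<close>

lemma nn_integral_distr_le:
  assumes T: "T \<in> measurable M N"
  shows "(\<integral>\<^sup>+x. f x \<partial>distr M N T) \<le> (\<integral>\<^sup>+x. f (T x) \<partial>M)"
proof -
  have "integral\<^sup>S (distr M N T) s \<le> (\<integral>\<^sup>+x. f (T x) \<partial>M)"
    if "simple_function (distr M N T) s" "s \<le> f" for s
  proof -
    have [measurable]: "s \<in> borel_measurable N"
      using borel_measurable_simple_function[OF that(1)] by simp
    have "integral\<^sup>S (distr M N T) s = (\<integral>\<^sup>+x. s x \<partial>distr M N T)"
      by (rule nn_integral_eq_simple_integral[symmetric, OF that(1)])
    also have "\<dots> = (\<integral>\<^sup>+x. s (T x) \<partial>M)"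
      using T by (intro nn_integral_distr) auto
    also have "\<dots> \<le> (\<integral>\<^sup>+x. f (T x) \<partial>M)"
      using that(2) by (intro nn_integral_mono) (simp add: le_fun_def)
    finally show ?thesis .
  qed
  then show ?thesis
    unfolding nn_integral_def[of "distr M N T"] by (intro SUP_least) auto
qed

section \<open>Metric Borel spaces\<close>

lemma space_metric_borel [simp]: "space (metric_borel S d) = S"
  unfolding metric_borel_def by (rule space_measure_of) auto

lemma sets_metric_borelI:
  assumes "U \<subseteq> S" "\<And>x. x \<in> U \<Longrightarrow> \<exists>r>0. \<forall>y\<in>S. d x y < r \<longrightarrow> y \<in> U"
  shows "U \<in> sets (metric_borel S d)"
  unfolding metric_borel_def using assms by (subst sets_measure_of) auto

lemma Lipschitz_borel_measurable_metric_borel: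
  fixes f :: "'a \<Rightarrow> 'b::metric_space"
  assumes "0 \<le> C" and "\<And>x y. x \<in> S \<Longrightarrow> y \<in> S \<Longrightarrow> dist (f x) (f y) \<le> C * d x y"
  shows "f \<in> borel_measurable (metric_borel S d)"
proof (rule borel_measurableI)
  fix U :: "'b set" assume "open U"
  show "f -` U \<inter> space (metric_borel S d) \<in> sets (metric_borel S d)"
  proof (rule sets_metric_borelI)
    fix x assume x: "x \<in> f -` U \<inter> space (metric_borel S d)"
    then obtain e where e: "e > 0" "\<And>z. dist z (f x) < e \<Longrightarrow> z \<in> U"
      using \<open>open U\<close> unfolding open_dist by blast
    have "dist (f y) (f x) < e" if "y \<in> S" "d x y < e / (C + 1)" for y
    proof -
      have "dist (f y) (f x) \<le> C * d x y"
        using assms(2)[of x y] x \<open>y \<in> S\<close> by (simp add: dist_commute)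
      also have "\<dots> \<le> C * (e / (C + 1))"
        using that(2) assms(1) by (intro mult_left_mono) auto
      also have "\<dots> < e"
        using assms(1) e(1) by (simp add: field_simps)
      finally show ?thesis .
    qed
    then show "\<exists>r>0. \<forall>y\<in>S. d x y < r \<longrightarrow> y \<in> f -` U \<inter> space (metric_borel S d)"
      using e by (intro exI[of _ "e / (C + 1)"]) (use assms(1) x in auto)
  qed auto
qed

text \<open>The ball condition alone shows that preimages of generators are generators.
  \<open>d\<close> and \<open>d'\<close> are arbitrary functions here, so the lemma applies directly
  to \<open>L2_dist\<close> and \<open>W2\<close>.\<close>

lemma metric_borel_measurableI:
  assumes "\<And>x. x \<in> S \<Longrightarrow> f x \<in> S'"
    and "\<And>x y. x \<in> S \<Longrightarrow> y \<in> S \<Longrightarrow> d' (f x) (f y) \<le> d x y"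
  shows "f \<in> measurable (metric_borel S d) (metric_borel S' d')"
  unfolding metric_borel_def[of S' d']
proof (rule measurable_measure_of)
  fix U assume U: "U \<in> {U. U \<subseteq> S' \<and> (\<forall>x\<in>U. \<exists>r>0. \<forall>y\<in>S'. d' x y < r \<longrightarrow> y \<in> U)}"
  show "f -` U \<inter> space (metric_borel S d) \<in> sets (metric_borel S d)"
  proof (rule sets_metric_borelI)
    fix x assume x: "x \<in> f -` U \<inter> space (metric_borel S d)"
    then obtain r where "r > 0" "\<forall>y\<in>S'. d' (f x) y < r \<longrightarrow> y \<in> U"
      using U by blast
    then show "\<exists>r>0. \<forall>y\<in>S. d x y < r \<longrightarrow> y \<in> f -` U \<inter> space (metric_borel S d)"
      using assms x by (intro exI[of _ r]) (force)
  qed auto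
qed (use assms in auto)

section \<open>The space $L^2$\<close>

lemma L2_fun_measurable: "f \<in> L2_fun Q \<Longrightarrow> f \<in> borel_measurable Q"
  by (simp add: L2_fun_def)

lemma L2_fun_add:
  fixes f g :: "'q \<Rightarrow> 'v::euclidean_space"
  assumes "f \<in> L2_fun Q" "g \<in> L2_fun Q"
  shows "(\<lambda>q. f q + g q) \<in> L2_fun Q"
proof -
  have [measurable]: "f \<in> borel_measurable Q" "g \<in> borel_measurable Q"
    using assms by (auto simp: L2_fun_def)
  have "integrable Q (\<lambda>q. (norm (f q + g q))\<^sup>2)"
  proof (rule Bochner_Integration.integrable_bound)
    show "integrable Q (\<lambda>q. 2 * (norm (f q))\<^sup>2 + 2 * (norm (g q))\<^sup>2)"
      using assms by (auto simp: L2_fun_def)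
    have "(norm (f q + g q))\<^sup>2 \<le> 2 * (norm (f q))\<^sup>2 + 2 * (norm (g q))\<^sup>2" for q
    proof -
      have "(norm (f q + g q))\<^sup>2 \<le> (norm (f q) + norm (g q))\<^sup>2"
        by (intro power_mono norm_triangle_ineq) auto
      also have "\<dots> \<le> 2 * (norm (f q))\<^sup>2 + 2 * (norm (g q))\<^sup>2"
        using sum_squares_bound[of "norm (f q)" "norm (g q)"] by (simp add: power2_sum)
      finally show ?thesis .
    qed
    then show "AE q in Q. norm ((norm (f q + g q))\<^sup>2) \<le> norm (2 * (norm (f q))\<^sup>2 + 2 * (norm (g q))\<^sup>2)"
      by simp
  qed simp
  then show ?thesis by (simp add: L2_fun_def)
qed

lemma L2_fun_scale:
  fixes f :: "'q \<Rightarrow> 'v::euclidean_space"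
  assumes "f \<in> L2_fun Q"
  shows "(\<lambda>q. c *\<^sub>R f q) \<in> L2_fun Q"
  using assms by (auto simp: L2_fun_def power_mult_distrib)

lemma L2_fun_scale_right:
  fixes f :: "'q \<Rightarrow> real" and x :: "'v::euclidean_space"
  assumes "f \<in> L2_fun Q"
  shows "(\<lambda>q. f q *\<^sub>R x) \<in> L2_fun Q"
  using assms by (auto simp: L2_fun_def power_mult_distrib)

lemma L2_fun_0: "(\<lambda>q. 0) \<in> L2_fun Q"
  by (auto simp: L2_fun_def)

lemma L2_fun_sum:
  fixes f :: "'i \<Rightarrow> 'q \<Rightarrow> 'v::euclidean_space"
  assumes "\<And>i. i \<in> I \<Longrightarrow> f i \<in> L2_fun Q"
  shows "(\<lambda>q. \<Sum>i\<in>I. f i q) \<in> L2_fun Q"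
  using assms
  by (induction I rule: infinite_finite_induct) (auto simp: L2_fun_0 intro!: L2_fun_add)

lemma L2_fun_diff:
  fixes f g :: "'q \<Rightarrow> 'v::euclidean_space"
  assumes "f \<in> L2_fun Q" "g \<in> L2_fun Q"
  shows "(\<lambda>q. f q - g q) \<in> L2_fun Q"
  using L2_fun_add[OF assms(1) L2_fun_scale[OF assms(2), of "-1"]] by simp

lemma L2_fun_inner:
  fixes f :: "'q \<Rightarrow> 'v::euclidean_space"
  assumes "f \<in> L2_fun Q"
  shows "(\<lambda>q. f q \<bullet> x) \<in> L2_fun Q"
proof -
  have [measurable]: "f \<in> borel_measurable Q"
    using assms by (auto simp: L2_fun_def)
  have "integrable Q (\<lambda>q. (f q \<bullet> x)\<^sup>2)"
  proof (rule Bochner_Integration.integrable_bound)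
    show "integrable Q (\<lambda>q. (norm x)\<^sup>2 * (norm (f q))\<^sup>2)"
      using assms by (auto simp: L2_fun_def)
    have "(f q \<bullet> x)\<^sup>2 \<le> (norm x)\<^sup>2 * (norm (f q))\<^sup>2" for q
      using power_mono[OF Cauchy_Schwarz_ineq2[of "f q" x] abs_ge_zero, of 2]
      by (simp add: power_mult_distrib mult.commute)
    then show "AE q in Q. norm ((f q \<bullet> x)\<^sup>2) \<le> norm ((norm x)\<^sup>2 * (norm (f q))\<^sup>2)"
      by simp
  qed simp
  then show ?thesis by (simp add: L2_fun_def)
qed

lemma L2_class_in_L2: "f \<in> L2_fun Q \<Longrightarrow> L2_class Q f \<in> L2 Q"
  by (auto simp: L2_def)

lemma L2_rep_class:
  assumes "f \<in> L2_fun Q"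
  shows "L2_rep (L2_class Q f) \<in> L2_fun Q" "AE q in Q. L2_rep (L2_class Q f) q = f q"
proof -
  have "f \<in> L2_class Q f" using assms by (auto simp: L2_class_def)
  then have "L2_rep (L2_class Q f) \<in> L2_class Q f"
    unfolding L2_rep_def by (rule someI[where P="\<lambda>g. g \<in> L2_class Q f"])
  then show "L2_rep (L2_class Q f) \<in> L2_fun Q" "AE q in Q. L2_rep (L2_class Q f) q = f q"
    by (auto simp: L2_class_def)
qed

lemma L2_class_cong_AE:
  assumes "AE q in Q. f q = g q"
  shows "L2_class Q f = L2_class Q g"
proof -
  have "(AE q in Q. h q = f q) \<longleftrightarrow> (AE q in Q. h q = g q)" for h
    using assms by (intro iffI; elim AE_mp) auto
  then show ?thesis by (simp add: L2_class_def)
qed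

lemma L2_rep_L2:
  assumes "X \<in> L2 Q"
  shows "L2_rep X \<in> L2_fun Q" "L2_class Q (L2_rep X) = X"
  using assms by (auto simp: L2_def L2_rep_class intro!: L2_class_cong_AE)

lemma L2_dist_class:
  fixes f g :: "'q \<Rightarrow> 'v::euclidean_space"
  assumes "f \<in> L2_fun Q" "g \<in> L2_fun Q"
  shows "L2_dist Q (L2_class Q f) (L2_class Q g) = sqrt (\<integral>q. (norm (f q - g q))\<^sup>2 \<partial>Q)"
proof -
  note [measurable] = assms[THEN L2_fun_measurable] assms[THEN L2_rep_class(1), THEN L2_fun_measurable]
  show ?thesis
    unfolding L2_dist_def
    by (intro arg_cong[where f=sqrt] integral_cong_AE)
       (use L2_rep_class(2)[OF assms(1)] L2_rep_class(2)[OF assms(2)] in auto)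
qed

lemma L2_norm_class:
  fixes f :: "'q \<Rightarrow> 'v::euclidean_space"
  assumes "f \<in> L2_fun Q"
  shows "L2_norm Q (L2_class Q f) = sqrt (\<integral>q. (norm (f q))\<^sup>2 \<partial>Q)"
proof -
  note [measurable] = assms[THEN L2_fun_measurable] assms[THEN L2_rep_class(1), THEN L2_fun_measurable]
  show ?thesis
    unfolding L2_norm_def
    by (intro arg_cong[where f=sqrt] integral_cong_AE)
       (use L2_rep_class(2)[OF assms(1)] in auto)
qed

lemma L2_dist_square:
  fixes X Y :: "('q \<Rightarrow> 'v::euclidean_space) set"
  assumes "X \<in> L2 Q" "Y \<in> L2 Q"
  shows "ennreal ((L2_dist Q X Y)\<^sup>2) = (\<integral>\<^sup>+q. ennreal ((norm (L2_rep X q - L2_rep Y q))\<^sup>2) \<partial>Q)"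
  using L2_fun_diff[OF L2_rep_L2(1)[OF assms(1)] L2_rep_L2(1)[OF assms(2)]]
  by (subst nn_integral_eq_integral) (auto simp: L2_dist_def L2_fun_def integral_nonneg_AE)

text \<open>Pointwise (a + b)^2 <= 2 a^2 + 2 b^2, integrated. The factor 2 is harmless where only
  finiteness of a moment is at stake.\<close>

lemma L2_dist_square_triangle:
  fixes X Y Z :: "('q \<Rightarrow> 'v::euclidean_space) set"
  assumes "X \<in> L2 Q" "Y \<in> L2 Q" "Z \<in> L2 Q"
  shows "(L2_dist Q X Z)\<^sup>2 \<le> 2 * (L2_dist Q X Y)\<^sup>2 + 2 * (L2_dist Q Y Z)\<^sup>2"
proof -
  note X = L2_rep_L2(1)[OF assms(1)] and Y = L2_rep_L2(1)[OF assms(2)] and Z = L2_rep_L2(1)[OF assms(3)]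
  have int: "integrable Q (\<lambda>q. (norm (f q - g q))\<^sup>2)"
    if "f \<in> L2_fun Q" "g \<in> L2_fun Q" for f g :: "'q \<Rightarrow> 'v"
    using L2_fun_diff[OF that] by (simp add: L2_fun_def)
  have "(\<integral>q. (norm (L2_rep X q - L2_rep Z q))\<^sup>2 \<partial>Q)
      \<le> (\<integral>q. 2 * (norm (L2_rep X q - L2_rep Y q))\<^sup>2 + 2 * (norm (L2_rep Y q - L2_rep Z q))\<^sup>2 \<partial>Q)"
  proof (rule integral_mono)
    fix q
    let ?a = "L2_rep X q - L2_rep Y q" and ?b = "L2_rep Y q - L2_rep Z q"
    have "norm (L2_rep X q - L2_rep Z q) \<le> norm ?a + norm ?b"
      using norm_triangle_ineq[of ?a ?b] by simp
    then have "(norm (L2_rep X q - L2_rep Z q))\<^sup>2 \<le> (norm ?a + norm ?b)\<^sup>2"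
      by (intro power_mono) auto
    also have "\<dots> \<le> 2 * (norm ?a)\<^sup>2 + 2 * (norm ?b)\<^sup>2"
      using sum_squares_bound[of "norm ?a" "norm ?b"] by (simp add: power2_sum)
    finally show "(norm (L2_rep X q - L2_rep Z q))\<^sup>2 \<le> 2 * (norm ?a)\<^sup>2 + 2 * (norm ?b)\<^sup>2" .
  qed (use int X Y Z in auto)
  also have "\<dots> = 2 * (\<integral>q. (norm (L2_rep X q - L2_rep Y q))\<^sup>2 \<partial>Q) + 2 * (\<integral>q. (norm (L2_rep Y q - L2_rep Z q))\<^sup>2 \<partial>Q)"
    using int X Y Z by simp
  finally show ?thesis by (simp add: L2_dist_def integral_nonneg_AE)
qed

section \<open>Couplings and the map $\iota$\<close>

lemma P2_prob: "\<mu> \<in> P2 \<Longrightarrow> prob_space \<mu>" and P2_sets: "\<mu> \<in> P2 \<Longrightarrow> sets \<mu> = sets borel"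
  by (auto simp: P2_def)

lemma coupling_prob:
  assumes "prob_space \<mu>" "\<gamma> \<in> couplings \<mu> \<nu>"
  shows "prob_space \<gamma>"
proof (rule prob_space_distrD[where f=fst and N=borel])
  show "fst \<in> \<gamma> \<rightarrow>\<^sub>M borel"
    using assms by (simp add: couplings_def cong: measurable_cong_sets)
qed (use assms in \<open>auto simp: couplings_def\<close>)

lemma nn_integral_coupling:
  assumes "\<gamma> \<in> couplings \<mu> \<nu>" "f \<in> borel_measurable borel"
  shows "(\<integral>\<^sup>+x. f x \<partial>\<mu>) = (\<integral>\<^sup>+z. f (fst z) \<partial>\<gamma>)" "(\<integral>\<^sup>+x. f x \<partial>\<nu>) = (\<integral>\<^sup>+z. f (snd z) \<partial>\<gamma>)"
proof -
  have s: "sets \<gamma> = sets (borel \<Otimes>\<^sub>M borel)" "\<mu> = distr \<gamma> borel fst" "\<nu> = distr \<gamma> borel snd"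
    using assms by (auto simp: couplings_def)
  have "fst \<in> \<gamma> \<rightarrow>\<^sub>M borel" "snd \<in> \<gamma> \<rightarrow>\<^sub>M borel"
    by (simp_all add: s(1) cong: measurable_cong_sets)
  then show "(\<integral>\<^sup>+x. f x \<partial>\<mu>) = (\<integral>\<^sup>+z. f (fst z) \<partial>\<gamma>)" "(\<integral>\<^sup>+x. f x \<partial>\<nu>) = (\<integral>\<^sup>+z. f (snd z) \<partial>\<gamma>)"
    unfolding s(2,3) using assms(2) by (auto intro: nn_integral_distr)
qed

text \<open>\<open>W2\<close> is defined through \<open>enn2real\<close>, which sends infinity to 0,
  so an upper bound on \<open>W2\<close> yields cheap couplings only once the infimum is known to be
  finite. The product measure is a coupling of finite cost.\<close>

lemma W2_cost_finite:
  fixes \<mu> \<nu> :: "'v::euclidean_space measure"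
  assumes "\<mu> \<in> P2" "\<nu> \<in> P2"
  shows "(INF \<gamma>\<in>couplings \<mu> \<nu>. \<integral>\<^sup>+ z. ennreal ((dist (fst z) (snd z))\<^sup>2) \<partial>\<gamma>) < \<infinity>"
proof -
  interpret M: prob_space \<mu> using assms P2_prob by auto
  interpret N: prob_space \<nu> using assms P2_prob by auto
  interpret MN: pair_prob_space \<mu> \<nu> ..
  have s: "sets \<mu> = sets borel" "sets \<nu> = sets borel" using assms P2_sets by auto
  note [measurable_cong] = s
  have c: "\<mu> \<Otimes>\<^sub>M \<nu> \<in> couplings \<mu> \<nu>"
  proof -
    have "distr (\<mu> \<Otimes>\<^sub>M \<nu>) borel fst = \<mu>" "distr (\<mu> \<Otimes>\<^sub>M \<nu>) borel snd = \<nu>"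
      by (auto intro!: measure_eqI simp: emeasure_distr s space_pair_measure sets_eq_imp_space_eq[OF s(1)]
          sets_eq_imp_space_eq[OF s(2)] vimage_fst vimage_snd M.emeasure_space_1 N.emeasure_space_1
          N.emeasure_pair_measure_Times Times_Int_Times
          M.emeasure_space_1[unfolded sets_eq_imp_space_eq[OF s(1)], simplified]
          N.emeasure_space_1[unfolded sets_eq_imp_space_eq[OF s(2)], simplified])
    moreover have "sets (\<mu> \<Otimes>\<^sub>M \<nu>) = sets (borel \<Otimes>\<^sub>M borel)"
      by (intro sets_pair_measure_cong s)
    ultimately show ?thesis by (simp add: couplings_def)
  qed
  have "(INF \<gamma>\<in>couplings \<mu> \<nu>. \<integral>\<^sup>+ z. ennreal ((dist (fst z) (snd z))\<^sup>2) \<partial>\<gamma>)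
      \<le> (\<integral>\<^sup>+ z. ennreal ((dist (fst z) (snd z))\<^sup>2) \<partial>(\<mu> \<Otimes>\<^sub>M \<nu>))"
    using c by (rule INF_lower)
  also have "\<dots> \<le> (\<integral>\<^sup>+ z. 2 * ennreal ((norm (fst z))\<^sup>2) + 2 * ennreal ((norm (snd z))\<^sup>2) \<partial>(\<mu> \<Otimes>\<^sub>M \<nu>))"
  proof (rule nn_integral_mono)
    fix z :: "'v \<times> 'v"
    have "(dist (fst z) (snd z))\<^sup>2 \<le> (norm (fst z) + norm (snd z))\<^sup>2"
      by (intro power_mono) (auto simp: dist_norm norm_triangle_ineq4)
    also have "\<dots> \<le> 2 * (norm (fst z))\<^sup>2 + 2 * (norm (snd z))\<^sup>2"
      using sum_squares_bound[of "norm (fst z)" "norm (snd z)"] by (simp add: power2_sum)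
    finally show "ennreal ((dist (fst z) (snd z))\<^sup>2) \<le> 2 * ennreal ((norm (fst z))\<^sup>2) + 2 * ennreal ((norm (snd z))\<^sup>2)"
      by (simp flip: ennreal_numeral ennreal_mult ennreal_plus add: ennreal_leI)
  qed
  also have "\<dots> = 2 * (\<integral>\<^sup>+ z. ennreal ((norm (fst z))\<^sup>2) \<partial>(\<mu> \<Otimes>\<^sub>M \<nu>)) + 2 * (\<integral>\<^sup>+ z. ennreal ((norm (snd z))\<^sup>2) \<partial>(\<mu> \<Otimes>\<^sub>M \<nu>))"
    by (subst nn_integral_add) (auto simp: nn_integral_cmult)
  also have "\<dots> = 2 * (\<integral>\<^sup>+ z. ennreal ((norm z)\<^sup>2) \<partial>\<mu>) + 2 * (\<integral>\<^sup>+ z. ennreal ((norm z)\<^sup>2) \<partial>\<nu>)"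
    using nn_integral_coupling[OF c, of "\<lambda>x. ennreal ((norm x)\<^sup>2)"] by simp
  also have "\<dots> < \<infinity>"
    using assms by (auto simp: P2_def ennreal_mult_less_top)
  finally show ?thesis .
qed

lemma W2_less_imp_coupling:
  fixes \<mu> \<nu> :: "'v::euclidean_space measure"
  assumes "\<mu> \<in> P2" "\<nu> \<in> P2" "W2 \<mu> \<nu> < c"
  shows "\<exists>\<gamma>\<in>couplings \<mu> \<nu>. (\<integral>\<^sup>+ z. ennreal ((dist (fst z) (snd z))\<^sup>2) \<partial>\<gamma>) < ennreal (c\<^sup>2)"
proof -
  let ?I = "INF \<gamma>\<in>couplings \<mu> \<nu>. \<integral>\<^sup>+ z. ennreal ((dist (fst z) (snd z))\<^sup>2) \<partial>\<gamma>"
  have "sqrt (enn2real ?I) < c" using assms(3) by (simp add: W2_def)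
  moreover have "0 \<le> sqrt (enn2real ?I)" by simp
  ultimately have "enn2real ?I < c\<^sup>2"
    by (smt (verit) real_sqrt_less_iff real_sqrt_abs)
  then have "ennreal (enn2real ?I) < ennreal (c\<^sup>2)"
    using enn2real_nonneg[of ?I] by (intro ennreal_lessI) linarith+
  moreover have "ennreal (enn2real ?I) = ?I"
    by (rule ennreal_enn2real) (use W2_cost_finite[OF assms(1,2)] in simp)
  ultimately have "?I < ennreal (c\<^sup>2)"
    by (simp only:)
  then show ?thesis by (simp add: INF_less_iff)
qed

lemma W2_le:
  assumes "\<gamma> \<in> couplings \<mu> \<nu>" "(\<integral>\<^sup>+ z. ennreal ((dist (fst z) (snd z))\<^sup>2) \<partial>\<gamma>) \<le> ennreal (c\<^sup>2)" "c \<ge> 0"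
  shows "W2 \<mu> \<nu> \<le> c"
proof -
  let ?I = "INF \<gamma>\<in>couplings \<mu> \<nu>. \<integral>\<^sup>+ z. ennreal ((dist (fst z) (snd z))\<^sup>2) \<partial>\<gamma>"
  have "?I \<le> ennreal (c\<^sup>2)"
    using INF_lower[OF assms(1)] assms(2) by (rule order_trans)
  then have "enn2real ?I \<le> c\<^sup>2"
    by (simp add: enn2real_leI)
  then show ?thesis unfolding W2_def using assms(3) by (metis real_sqrt_le_iff real_sqrt_unique)
qed

lemma iota_class:
  assumes "f \<in> L2_fun Q"
  shows "iota Q (L2_class Q f) = distr Q borel f"
  unfolding iota_def
  by (rule distr_cong_AE) (use assms L2_rep_class[OF assms] in \<open>auto simp: L2_fun_def\<close>)

lemma iota_in_P2:
  fixes X :: "('q \<Rightarrow> 'v::euclidean_space) set"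
  assumes "prob_space Q" "X \<in> L2 Q"
  shows "iota Q X \<in> P2"
proof -
  interpret prob_space Q by fact
  have X: "L2_rep X \<in> borel_measurable Q" "integrable Q (\<lambda>q. (norm (L2_rep X q))\<^sup>2)"
    using L2_rep_L2(1)[OF assms(2)] by (auto simp: L2_fun_def)
  have "(\<integral>\<^sup>+q. ennreal ((norm (L2_rep X q))\<^sup>2) \<partial>Q) < \<infinity>"
    using X(2) by (subst nn_integral_eq_integral) auto
  then show ?thesis
    using X(1) by (auto simp: P2_def iota_def nn_integral_distr intro: prob_space_distr)
qed

text \<open>The joint law of the two representatives under \<open>Q\<close> is the coupling. It
  serves both for the Lipschitz bound on \<open>iota\<close> and for comparing
  \<open>\<Xi> \<omega>\<close> with its partial sums.\<close>

lemma iota_coupling: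
  fixes X Y :: "('q \<Rightarrow> 'v::euclidean_space) set"
  assumes "X \<in> L2 Q" "Y \<in> L2 Q"
  obtains \<gamma> where "\<gamma> \<in> couplings (iota Q X) (iota Q Y)"
    "(\<integral>\<^sup>+ z. ennreal ((dist (fst z) (snd z))\<^sup>2) \<partial>\<gamma>) = ennreal ((L2_dist Q X Y)\<^sup>2)"
proof
  have [measurable]: "L2_rep X \<in> borel_measurable Q" "L2_rep Y \<in> borel_measurable Q"
    using L2_rep_L2(1)[OF assms(1)] L2_rep_L2(1)[OF assms(2)] by (auto simp: L2_fun_def)
  let ?g = "distr Q (borel \<Otimes>\<^sub>M borel) (\<lambda>q. (L2_rep X q, L2_rep Y q))"
  show "?g \<in> couplings (iota Q X) (iota Q Y)"
    by (auto simp: couplings_def iota_def distr_distr comp_def)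
  show "(\<integral>\<^sup>+ z. ennreal ((dist (fst z) (snd z))\<^sup>2) \<partial>?g) = ennreal ((L2_dist Q X Y)\<^sup>2)"
    using L2_dist_square[OF assms] by (simp add: nn_integral_distr dist_norm)
qed

lemma W2_iota_le:
  fixes X Y :: "('q \<Rightarrow> 'v::euclidean_space) set"
  assumes "X \<in> L2 Q" "Y \<in> L2 Q"
  shows "W2 (iota Q X) (iota Q Y) \<le> L2_dist Q X Y"
proof -
  have "0 \<le> L2_dist Q X Y" by (simp add: L2_dist_def integral_nonneg_AE)
  moreover obtain \<gamma> where "\<gamma> \<in> couplings (iota Q X) (iota Q Y)"
    "(\<integral>\<^sup>+ z. ennreal ((dist (fst z) (snd z))\<^sup>2) \<partial>\<gamma>) = ennreal ((L2_dist Q X Y)\<^sup>2)"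
    using iota_coupling[OF assms] .
  ultimately show ?thesis
    using W2_le[of \<gamma>] by simp
qed

lemma iota_measurable:
  fixes Q :: "'q measure"
  assumes "prob_space Q"
  shows "(iota Q :: ('q \<Rightarrow> 'v::euclidean_space) set \<Rightarrow> _) \<in> measurable (L2_borel Q) P2_borel"
  unfolding L2_borel_def P2_borel_def
  by (rule metric_borel_measurableI) (auto intro: iota_in_P2[OF assms] W2_iota_le)

section \<open>Close pairs\<close>

text \<open>\<open>close_pairs (2 * r)\<close> is the J_r of the overview. The inequality on the
  distance is strict, an open condition; this makes the quantity lower semicontinuous in the
  measure.\<close>

definition close_pairs :: "real \<Rightarrow> 'v::metric_space measure \<Rightarrow> ennreal" where
  "close_pairs a \<mu> = (\<integral>\<^sup>+x. \<integral>\<^sup>+y. indicator {..<a} (dist x y) \<partial>\<mu> \<partial>\<mu>)"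

lemma indicator_dist_measurable [measurable]:
  fixes f g :: "'a \<Rightarrow> 'v::euclidean_space"
  assumes [measurable]: "f \<in> borel_measurable M" "g \<in> borel_measurable M"
  shows "(\<lambda>x. indicator {..<a::real} (dist (f x) (g x)) :: ennreal) \<in> borel_measurable M"
  by measurable

text \<open>If both points move by less than \<open>s\<close>, their distance changes by less than
  \<open>2 * s\<close>. If one of them moves by at least \<open>s\<close>, its quadratic term is
  already at least 1: Markov's inequality in pointwise form.\<close>

lemma indicator_dist_perturb:
  fixes x x' y y' :: "'v::euclidean_space"
  assumes "s > 0"
  shows "(indicator {..<a} (dist x x') :: ennreal)
    \<le> indicator {..<a + 2 * s} (dist y y') + ennreal (1 / s\<^sup>2) * ennreal ((dist x y)\<^sup>2)
       + ennreal (1 / s\<^sup>2) * ennreal ((dist x' y')\<^sup>2)"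
proof -
  have e: "1 \<le> ennreal (1 / s\<^sup>2) * ennreal (t\<^sup>2)" if "t \<ge> s" for t
  proof -
    have "s\<^sup>2 \<le> t\<^sup>2" using that assms by (intro power_mono) auto
    then have "1 \<le> 1 / s\<^sup>2 * t\<^sup>2" using assms by (simp add: field_simps)
    then show ?thesis by (simp flip: ennreal_mult add: ennreal_le_1 ennreal_leI flip: ennreal_1)
  qed
  consider "dist x x' \<ge> a" | "dist x y \<ge> s" | "dist x' y' \<ge> s"
    | "dist x x' < a" "dist x y < s" "dist x' y' < s" by linarith
  then show ?thesis
  proof cases
    case 2
    then show ?thesis using e[of "dist x y"] 
      by (auto simp: indicator_def add_increasing add_increasing2)
  next
    case 3
    then show ?thesis using e[of "dist x' y'"] 
      by (auto simp: indicator_def add_increasing add_increasing2)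
  next
    case 4
    have "dist y y' \<le> dist y x + dist x x' + dist x' y'"
      using dist_triangle[of y y' x] dist_triangle[of x y' x'] by linarith
    with 4 have "dist y y' < a + 2 * s" by (simp add: dist_commute)
    then show ?thesis by (auto simp: indicator_def add_increasing add_increasing2)
  qed (simp add: indicator_def)
qed

text \<open>The pointwise bound \<open>indicator_dist_perturb\<close> is integrated over two
  independent copies of \<open>\<gamma>\<close>. Each copy contributes its transport cost divided by
  \<open>s\<^sup>2\<close>, whence the factor 2.\<close>

lemma close_pairs_coupling:
  fixes \<mu> \<nu> :: "'v::euclidean_space measure"
  assumes "prob_space \<mu>" "\<gamma> \<in> couplings \<mu> \<nu>" "s > 0"
  shows "close_pairs a \<mu> \<le> close_pairs (a + 2 * s) \<nu>
    + ennreal (2 / s\<^sup>2) * (\<integral>\<^sup>+ z. ennreal ((dist (fst z) (snd z))\<^sup>2) \<partial>\<gamma>)"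
proof -
  interpret G: prob_space \<gamma> by (rule coupling_prob[OF assms(1,2)])
  have "distr \<gamma> borel snd = \<nu>" "sets \<gamma> = sets (borel \<Otimes>\<^sub>M borel)"
    and sm: "sets \<mu> = sets borel" "sets \<nu> = sets borel"
    using assms(2) by (auto simp: couplings_def)
  have "snd \<in> \<gamma> \<rightarrow>\<^sub>M borel"
    by (simp add: \<open>sets \<gamma> = _\<close> cong: measurable_cong_sets)
  then have "prob_space \<nu>"
    using G.prob_space_distr[of snd borel] \<open>distr \<gamma> borel snd = \<nu>\<close> by simp
  interpret M: prob_space \<mu> by fact
  interpret N: prob_space \<nu> by fact
  note [measurable_cong] = \<open>sets \<gamma> = _\<close> sm
  let ?C = "\<integral>\<^sup>+ z. ennreal ((dist (fst z) (snd z))\<^sup>2) \<partial>\<gamma>"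
  let ?e = "\<lambda>z::'v \<times> 'v. ennreal (1 / s\<^sup>2) * ennreal ((dist (fst z) (snd z))\<^sup>2)"
  have E: "(\<integral>\<^sup>+z. ?e z \<partial>\<gamma>) = ennreal (1 / s\<^sup>2) * ?C"
    by (rule nn_integral_cmult) measurable
  have "close_pairs a \<mu> = (\<integral>\<^sup>+z. \<integral>\<^sup>+w. indicator {..<a} (dist (fst z) (fst w)) \<partial>\<gamma> \<partial>\<gamma>)"
  proof -
    have "close_pairs a \<mu> = (\<integral>\<^sup>+z. \<integral>\<^sup>+y. indicator {..<a} (dist (fst z) y) \<partial>\<mu> \<partial>\<gamma>)"
      unfolding close_pairs_def
      by (rule nn_integral_coupling(1)[OF assms(2)]) measurable
    also have "\<dots> = (\<integral>\<^sup>+z. \<integral>\<^sup>+w. indicator {..<a} (dist (fst z) (fst w)) \<partial>\<gamma> \<partial>\<gamma>)"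
      by (intro nn_integral_cong nn_integral_coupling(1)[OF assms(2)]) measurable
    finally show ?thesis .
  qed
  also have "\<dots> \<le> (\<integral>\<^sup>+z. \<integral>\<^sup>+w. indicator {..<a + 2 * s} (dist (snd z) (snd w)) + ?e z + ?e w \<partial>\<gamma> \<partial>\<gamma>)"
    by (intro nn_integral_mono indicator_dist_perturb[OF assms(3)])
  also have "\<dots> = (\<integral>\<^sup>+z. (\<integral>\<^sup>+w. indicator {..<a + 2 * s} (dist (snd z) (snd w)) \<partial>\<gamma>) + ?e z
      + ennreal (1 / s\<^sup>2) * ?C \<partial>\<gamma>)"
    by (intro nn_integral_cong) (simp add: nn_integral_add E G.emeasure_space_1)
  also have "\<dots> = (\<integral>\<^sup>+z. \<integral>\<^sup>+w. indicator {..<a + 2 * s} (dist (snd z) (snd w)) \<partial>\<gamma> \<partial>\<gamma>)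
      + ennreal (1 / s\<^sup>2) * ?C + ennreal (1 / s\<^sup>2) * ?C"
    by (subst nn_integral_add, measurable)+ (simp add: E G.emeasure_space_1)
  also have "(\<integral>\<^sup>+z. \<integral>\<^sup>+w. indicator {..<a + 2 * s} (dist (snd z) (snd w)) \<partial>\<gamma> \<partial>\<gamma>) = close_pairs (a + 2 * s) \<nu>"
  proof -
    have "close_pairs (a + 2 * s) \<nu> = (\<integral>\<^sup>+z. \<integral>\<^sup>+y. indicator {..<a + 2 * s} (dist (snd z) y) \<partial>\<nu> \<partial>\<gamma>)"
      unfolding close_pairs_def
      by (rule nn_integral_coupling(2)[OF assms(2)]) measurable
    also have "\<dots> = (\<integral>\<^sup>+z. \<integral>\<^sup>+w. indicator {..<a + 2 * s} (dist (snd z) (snd w)) \<partial>\<gamma> \<partial>\<gamma>)"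
      by (intro nn_integral_cong nn_integral_coupling(2)[OF assms(2)]) measurable
    finally show ?thesis ..
  qed
  also have "close_pairs (a + 2 * s) \<nu> + ennreal (1 / s\<^sup>2) * ?C + ennreal (1 / s\<^sup>2) * ?C
      = close_pairs (a + 2 * s) \<nu> + ennreal (2 / s\<^sup>2) * ?C"
  proof -
    have "ennreal (2 / s\<^sup>2) = ennreal (1 / s\<^sup>2) + ennreal (1 / s\<^sup>2)"
      by (simp flip: ennreal_plus)
    then show ?thesis by (simp add: distrib_right add.assoc)
  qed
  finally show ?thesis .
qed

text \<open>Left continuity in the radius, by monotone convergence; it rests on the strict
  inequality in \<open>close_pairs\<close>. The form \<open>a - 2 * s\<close> anticipates the loss
  of \<open>2 * s\<close> in \<open>close_pairs_coupling\<close>.\<close>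

lemma close_pairs_less_imp_smaller:
  fixes \<mu> :: "'v::euclidean_space measure"
  assumes "prob_space \<mu>" "sets \<mu> = sets borel" "c < close_pairs a \<mu>"
  obtains s where "s > 0" "c < close_pairs (a - 2 * s) \<mu>"
proof -
  interpret prob_space \<mu> by fact
  note [measurable_cong] = assms(2)
  let ?a = "\<lambda>n. a - 2 * (1 / real (Suc n))"
  have inc: "incseq (\<lambda>n. indicator {..<?a n} t :: ennreal)" for t
  proof (intro incseq_SucI)
    fix n
    have "?a n \<le> ?a (Suc n)" by (simp add: frac_le)
    then show "(indicator {..<?a n} t :: ennreal) \<le> indicator {..<?a (Suc n)} t"
      by (auto simp: indicator_def)
  qed
  have sup: "indicator {..<a} t = (SUP n. indicator {..<?a n} t :: ennreal)" for t
  proof (cases "t < a")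
    case True
    then obtain n where "1 / real (Suc n) < (a - t) / 2"
      using nat_approx_posE[of "(a - t) / 2"] by auto
    then have "t < ?a n" by simp
    then have "(1::ennreal) \<le> (SUP n. indicator {..<?a n} t)"
      by (intro SUP_upper2[of n]) (auto simp: indicator_def)
    moreover have "(SUP n. indicator {..<?a n} t) \<le> (1::ennreal)"
      by (intro SUP_least) (auto simp: indicator_def)
    ultimately show ?thesis using True by (simp add: antisym)
  next
    case False
    have "\<not> t < ?a n" for n
      using False by (smt (verit) divide_nonneg_nonneg of_nat_0_le_iff)
    then show ?thesis using False by simp
  qed
  have "close_pairs a \<mu> = (\<integral>\<^sup>+x. \<integral>\<^sup>+y. (SUP n. indicator {..<?a n} (dist x y)) \<partial>\<mu> \<partial>\<mu>)"
    unfolding close_pairs_def by (simp only: sup)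
  also have "\<dots> = (\<integral>\<^sup>+x. (SUP n. \<integral>\<^sup>+y. indicator {..<?a n} (dist x y) \<partial>\<mu>) \<partial>\<mu>)"
    by (intro nn_integral_cong nn_integral_monotone_convergence_SUP)
       (use inc in \<open>auto simp: incseq_def le_fun_def\<close>)
  also have "\<dots> = (SUP n. close_pairs (?a n) \<mu>)"
    unfolding close_pairs_def
    by (intro nn_integral_monotone_convergence_SUP)
       (use inc in \<open>auto simp: incseq_def le_fun_def intro!: nn_integral_mono\<close>)
  finally have "c < (SUP n. close_pairs (?a n) \<mu>)" using assms(3) by simp
  then obtain n where "c < close_pairs (?a n) \<mu>" by (auto simp: less_SUP_iff)
  then show thesis by (intro that[of "1 / real (Suc n)"]) auto
qed

lemma ennreal_less_add_pos:
  fixes c D :: ennreal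
  assumes "c < D"
  obtains e where "e > 0" "c + ennreal e < D"
proof -
  \<comment> \<open>The intermediate \<open>d\<close> is finite even if \<open>D\<close> is
    infinite, so real arithmetic becomes available.\<close>
  obtain d where d: "c < d" "d < D" using dense[OF assms] by blast
  then have "c < \<top>" "d < \<top>" by (auto intro: less_le_trans)
  then obtain c' d' where c': "c = ennreal c'" "0 \<le> c'" and d': "d = ennreal d'" "0 \<le> d'"
    by (cases c; cases d) auto
  have "c' < d'" using d(1) c' d' by (simp add: ennreal_less_iff)
  then have "c + ennreal (d' - c') = d" using c' d' by (simp flip: ennreal_plus)
  with that[of "d' - c'"] \<open>c' < d'\<close> d(2) show thesis by simp
qed

text \<open>Lower semicontinuity: by Markov's inequality a nearby measure has almost as many pairs at a
  slightly larger distance.\<close>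

lemma close_pairs_measurable:
  "(close_pairs a :: 'v::euclidean_space measure \<Rightarrow> ennreal) \<in> borel_measurable P2_borel"
proof (rule borel_measurableI_greater)
  fix c
  show "{\<mu> \<in> space (P2_borel :: 'v measure measure). c < close_pairs a \<mu>} \<in> sets P2_borel"
    unfolding P2_borel_def space_metric_borel
  proof (rule sets_metric_borelI)
    fix \<mu> :: "'v measure" assume \<mu>: "\<mu> \<in> {\<mu> \<in> P2. c < close_pairs a \<mu>}"
    then obtain s where s: "s > 0" "c < close_pairs (a - 2 * s) \<mu>"
      using close_pairs_less_imp_smaller P2_prob P2_sets by blast
    obtain e :: real where e: "e > 0" "c + ennreal e < close_pairs (a - 2 * s) \<mu>"
      using ennreal_less_add_pos[OF s(2)] .
    \<comment> \<open>Chosen so that a coupling of cost less than \<open>r\<^sup>2\<close> produces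
      an error of at most \<open>e\<close>.\<close>
    define r where "r = sqrt (e / 2) * s"
    have r: "r > 0" "2 / s\<^sup>2 * r\<^sup>2 = e"
      using s e by (auto simp: r_def power_mult_distrib)
    have "c < close_pairs a \<nu>" if \<nu>: "\<nu> \<in> P2" "W2 \<mu> \<nu> < r" for \<nu>
    proof (rule ccontr)
      assume "\<not> c < close_pairs a \<nu>"
      obtain \<gamma> where \<gamma>: "\<gamma> \<in> couplings \<mu> \<nu>"
        "(\<integral>\<^sup>+ z. ennreal ((dist (fst z) (snd z))\<^sup>2) \<partial>\<gamma>) < ennreal (r\<^sup>2)"
        using W2_less_imp_coupling[OF _ \<nu>] \<mu> by auto
      have "close_pairs (a - 2 * s) \<mu> \<le> close_pairs a \<nu>
          + ennreal (2 / s\<^sup>2) * (\<integral>\<^sup>+ z. ennreal ((dist (fst z) (snd z))\<^sup>2) \<partial>\<gamma>)"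
        using close_pairs_coupling[OF _ \<gamma>(1) s(1), of "a - 2 * s"] \<mu> P2_prob by auto
      also have "\<dots> \<le> c + ennreal (2 / s\<^sup>2) * ennreal (r\<^sup>2)"
        using \<open>\<not> c < close_pairs a \<nu>\<close> \<gamma>(2) by (intro add_mono mult_left_mono) auto
      also have "\<dots> = c + ennreal e"
        using r by (simp flip: ennreal_mult)
      finally show False using e by simp
    qed
    then show "\<exists>r>0. \<forall>\<nu>\<in>P2. W2 \<mu> \<nu> < r \<longrightarrow> \<nu> \<in> {\<mu> \<in> P2. c < close_pairs a \<mu>}"
      using r(1) by blast
  qed auto
qed

text \<open>Integrate \<open>x \<mapsto> \<mu>(B(x,r))\<close> over \<open>U\<close> and apply the Cauchy--Schwarz inequality.\<close>

lemma emeasure_inner_ball_le: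
  fixes \<mu> :: "'v::euclidean_space measure"
  assumes "prob_space \<mu>" "sets \<mu> = sets borel" "open U" "r > 0" "V \<in> sets borel"
    and V: "\<And>y. y \<in> V \<Longrightarrow> ball y r \<subseteq> U"
  shows "(emeasure \<mu> V)\<^sup>2 * ennreal (unit_ball_vol (DIM('v)) * r ^ DIM('v))
      \<le> emeasure lborel U * close_pairs (2 * r) \<mu>"
proof -
  interpret prob_space \<mu> by fact
  interpret pair_sigma_finite \<mu> "lborel :: 'v measure" ..
  interpret L: pair_sigma_finite "lborel :: 'v measure" \<mu> ..
  note [measurable_cong] = assms(2)
  have [measurable]: "U \<in> sets borel" "V \<in> sets borel" using assms by auto
  let ?b = "ennreal (unit_ball_vol (DIM('v)) * r ^ DIM('v))"
  let ?K = "\<lambda>x y::'v. indicator {..<r} (dist x y) :: ennreal"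
  let ?g = "\<lambda>x. \<integral>\<^sup>+y. ?K x y \<partial>\<mu>"
  have b: "(\<integral>\<^sup>+x. ?K x y \<partial>lborel) = ?b" for y :: 'v
  proof -
    have "(\<integral>\<^sup>+x. ?K x y \<partial>lborel) = (\<integral>\<^sup>+x. indicator (ball y r) x \<partial>lborel)"
      by (intro nn_integral_cong) (auto simp: indicator_def dist_commute)
    also have "\<dots> = ?b" using assms(4) by (simp add: emeasure_ball)
    finally show ?thesis .
  qed
  have "emeasure \<mu> V * ?b = (\<integral>\<^sup>+y. \<integral>\<^sup>+x. indicator V y * ?K x y \<partial>lborel \<partial>\<mu>)"
    by (simp add: nn_integral_cmult b nn_integral_multc)
  \<comment> \<open>A point x within \<open>r\<close> of a point of \<open>V\<close> lies in
    \<open>U\<close>, so the restriction passes from y to x.\<close>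
  also have "\<dots> \<le> (\<integral>\<^sup>+y. \<integral>\<^sup>+x. indicator U x * ?K x y \<partial>lborel \<partial>\<mu>)"
    using V by (intro nn_integral_mono) (force simp: indicator_def dist_commute subset_iff)
  also have "\<dots> = (\<integral>\<^sup>+x. \<integral>\<^sup>+y. indicator U x * ?K x y \<partial>\<mu> \<partial>lborel)"
    by (rule L.Fubini') measurable
  also have "\<dots> = (\<integral>\<^sup>+x. indicator U x * ?g x \<partial>lborel)"
    by (simp add: nn_integral_cmult)
  finally have "(emeasure \<mu> V * ?b)\<^sup>2 \<le> (\<integral>\<^sup>+x. indicator U x * ?g x \<partial>lborel)\<^sup>2"
    by (rule power_mono) simp
  also have "\<dots> \<le> (\<integral>\<^sup>+x. (indicator U x)\<^sup>2 \<partial>lborel) * (\<integral>\<^sup>+x. (?g x)\<^sup>2 \<partial>lborel)"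
    by (rule Cauchy_Schwarz_nn_integral) measurable
  also have "(\<integral>\<^sup>+x. (indicator U x)\<^sup>2 \<partial>lborel) = (\<integral>\<^sup>+x. indicator U x \<partial>lborel)"
    by (intro nn_integral_cong) (simp add: indicator_def)
  also have "\<dots> = emeasure lborel U" by simp
  also have "(\<integral>\<^sup>+x. (?g x)\<^sup>2 \<partial>lborel) = (\<integral>\<^sup>+x. \<integral>\<^sup>+y. \<integral>\<^sup>+z. ?K x y * ?K x z \<partial>\<mu> \<partial>\<mu> \<partial>lborel)"
    by (simp add: power2_eq_square nn_integral_cmult nn_integral_multc)
  also have "\<dots> = (\<integral>\<^sup>+y. \<integral>\<^sup>+x. \<integral>\<^sup>+z. ?K x y * ?K x z \<partial>\<mu> \<partial>lborel \<partial>\<mu>)"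
    by (rule Fubini') measurable
  also have "\<dots> = (\<integral>\<^sup>+y. \<integral>\<^sup>+z. \<integral>\<^sup>+x. ?K x y * ?K x z \<partial>lborel \<partial>\<mu> \<partial>\<mu>)"
    by (intro nn_integral_cong Fubini') measurable
  \<comment> \<open>Two points within \<open>r\<close> of a common x are within \<open>2 * r\<close>
    of each other. One kernel is kept, so that integrating out x leaves one ball volume
    \<open>?b\<close>; it cancels one of the two factors \<open>?b\<close> on the left-hand
    side.\<close>
  also have "\<dots> \<le> (\<integral>\<^sup>+y. \<integral>\<^sup>+z. \<integral>\<^sup>+x. indicator {..<2 * r} (dist y z) * ?K x y \<partial>lborel \<partial>\<mu> \<partial>\<mu>)"
  proof (intro nn_integral_mono)
    fix x y z :: 'v
    have "dist y z \<le> dist x y + dist x z"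
      by (rule dist_triangle3)
    then show "?K x y * ?K x z \<le> indicator {..<2 * r} (dist y z) * ?K x y"
      by (auto simp: indicator_def)
  qed
  also have "\<dots> = close_pairs (2 * r) \<mu> * ?b"
    by (simp add: nn_integral_cmult b nn_integral_multc close_pairs_def)
  finally have "(emeasure \<mu> V * ?b)\<^sup>2 \<le> emeasure lborel U * (close_pairs (2 * r) \<mu> * ?b)"
    by (simp add: mult_left_mono)
  then have "(emeasure \<mu> V)\<^sup>2 * ?b * ?b \<le> emeasure lborel U * close_pairs (2 * r) \<mu> * ?b"
    by (simp add: power2_eq_square ac_simps)
  moreover have "?b \<noteq> 0" "?b \<noteq> \<top>"
    using assms(4) by (auto simp: ennreal_eq_0_iff not_le)
  ultimately show ?thesis
    by (metis ennreal_mult_le_mult_iff mult.commute)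
qed

text \<open>Divided by r^d, the bound \<open>emeasure_inner_ball_le\<close> no longer mentions the
  radius: the square of the measure of an open set is at most a constant times its Lebesgue measure.
  Outer regularity of Lebesgue measure extends this to null sets.\<close>

lemma null_set_of_liminf_close_pairs:
  fixes \<mu> :: "'v::euclidean_space measure"
  assumes "prob_space \<mu>" "sets \<mu> = sets borel"
    and r: "\<And>k. r k > 0" "r \<longlonglongrightarrow> 0"
    and fin: "liminf (\<lambda>k. close_pairs (2 * r k) \<mu> / ennreal (r k ^ DIM('v))) < \<infinity>"
    and N: "N \<in> null_sets lborel"
  shows "N \<in> null_sets \<mu>"
proof -
  interpret prob_space \<mu> by fact
  let ?\<omega> = "ennreal (unit_ball_vol (DIM('v)))"
  let ?F = "\<lambda>k. close_pairs (2 * r k) \<mu> / ennreal (r k ^ DIM('v))"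
  obtain L where L: "liminf ?F < ennreal L" "L > 0"
  proof -
    obtain y where y: "liminf ?F < y" "y < \<top>"
      using dense[OF fin] by auto
    then have "0 < y" by (auto intro: le_less_trans[OF zero_le])
    with y that[of "enn2real y"] show thesis
      by (simp add: enn2real_positive_iff)
  qed
  \<comment> \<open>A liminf below \<open>L\<close> provides good indices arbitrarily far out, hence
    good radii as small as desired, although not every small radius need be good.\<close>
  have freq: "\<exists>k. r k \<le> e \<and> ?F k < ennreal L" if "e > 0" for e
  proof (rule ccontr)
    assume *: "\<not> (\<exists>k. r k \<le> e \<and> ?F k < ennreal L)"
    have "eventually (\<lambda>k. r k < e) sequentially"
      using order_tendstoD(2)[OF r(2) that] .
    then have "eventually (\<lambda>k. ennreal L \<le> ?F k) sequentially"
      by eventually_elim (use * in \<open>auto simp: not_less\<close>)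
    then have "ennreal L \<le> liminf ?F"
      by (rule Liminf_bounded)
    with L show False by simp
  qed
  have U: "(emeasure \<mu> U)\<^sup>2 * ?\<omega> \<le> emeasure lborel U * ennreal L" if "open U" for U
  proof -
    \<comment> \<open>Inner parallel sets: they increase to \<open>U\<close>, and each of them
      leaves room for balls of a fixed radius, so that some good radius fits.\<close>
    define V where "V n = {y. ball y (1 / real (Suc n)) \<subseteq> U}" for n
    have cl: "closed (V n)" for n
    proof -
      have "V n = (\<Inter>z\<in>-U. {y. dist y z \<ge> 1 / real (Suc n)})"
        by (auto simp: V_def subset_iff not_less) (metis ComplI linorder_not_less)
      moreover have "closed {y. dist y z \<ge> 1 / real (Suc n)}" for z :: 'v
        by (intro closed_Collect_le continuous_intros)
      ultimately show ?thesis by auto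
    qed
    then have [measurable]: "V n \<in> sets \<mu>" for n
      by (simp add: assms(2))
    have inc: "incseq V"
    proof (rule incseq_SucI)
      fix n
      have "1 / real (Suc (Suc n)) \<le> 1 / real (Suc n)" by (simp add: frac_le)
      then show "V n \<subseteq> V (Suc n)"
        unfolding V_def using subset_ball by blast
    qed
    have un: "(\<Union>n. V n) = U"
    proof
      show "(\<Union>n. V n) \<subseteq> U"
        by (auto simp: V_def subset_iff)
      show "U \<subseteq> (\<Union>n. V n)"
      proof
        fix y assume "y \<in> U"
        then obtain e where "e > 0" "ball y e \<subseteq> U"
          using \<open>open U\<close> open_contains_ball by blast
        moreover obtain n where "1 / real (Suc n) < e"
          using nat_approx_posE[OF \<open>e > 0\<close>] by auto
        ultimately have "y \<in> V n"
          by (force simp: V_def)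
        then show "y \<in> (\<Union>n. V n)" by blast
      qed
    qed
    have "(emeasure \<mu> (V n))\<^sup>2 * ?\<omega> \<le> emeasure lborel U * ennreal L" for n
    proof -
      obtain k where k: "r k \<le> 1 / real (Suc n)" "?F k < ennreal L"
        using freq[of "1 / real (Suc n)"] by auto
      let ?d = "ennreal (r k ^ DIM('v))"
      have d: "?d \<noteq> 0" "?d \<noteq> \<top>" using r(1)[of k] by (auto simp: ennreal_eq_0_iff not_le)
      have "ball y (r k) \<subseteq> U" if "y \<in> V n" for y
        using that k(1) unfolding V_def by (auto simp: subset_iff)
      then have "(emeasure \<mu> (V n))\<^sup>2 * ennreal (unit_ball_vol (DIM('v)) * r k ^ DIM('v))
          \<le> emeasure lborel U * close_pairs (2 * r k) \<mu>"
        by (intro emeasure_inner_ball_le assms \<open>open U\<close> r) (use cl in auto)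
      also have "close_pairs (2 * r k) \<mu> = ?F k * ?d"
        using d by (simp add: ennreal_divide_times ennreal_times_divide ennreal_mult_divide_eq)
      also have "\<dots> \<le> ennreal L * ?d"
        using k(2) by (intro mult_right_mono) auto
      finally have "(emeasure \<mu> (V n))\<^sup>2 * ?\<omega> * ?d \<le> emeasure lborel U * ennreal L * ?d"
        using r(1)[of k] by (simp add: ennreal_mult mult.assoc mult_left_mono)
      then show ?thesis
        using d by (metis ennreal_mult_le_mult_iff mult.commute)
    qed
    moreover have "(\<lambda>n. emeasure \<mu> (V n)) \<longlonglongrightarrow> emeasure \<mu> U"
      using Lim_emeasure_incseq[of V \<mu>, OF _ inc] by (simp add: un image_subset_iff)
    then have "(\<lambda>n. (emeasure \<mu> (V n))\<^sup>2 * ?\<omega>) \<longlonglongrightarrow> (emeasure \<mu> U)\<^sup>2 * ?\<omega>"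
      unfolding power2_eq_square
      by (intro tendsto_mult_ennreal tendsto_const) (auto simp: ennreal_mult_eq_top_iff less_imp_neq[OF unit_ball_vol_pos, symmetric])
    ultimately show ?thesis
      using LIMSEQ_le_const2 by blast
  qed
  have N': "N \<in> sets borel" "emeasure lborel N = 0"
    using N by (auto simp: null_sets_def)
  have small: "(emeasure \<mu> N)\<^sup>2 * ?\<omega> \<le> ennreal e" if "e > 0" for e
  proof -
    \<comment> \<open>Since \<open>N\<close> is null, the open set \<open>W\<close> itself has
      measure below \<open>e / L\<close>, which the bound for open sets turns into
      \<open>e\<close>.\<close>
    have "e / L > 0" using that L by simp
    then obtain W where W: "open W" "N \<subseteq> W" "emeasure lborel (W - N) < ennreal (e / L)"
      using outer_regular_lborel[OF N'(1)] by blast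
    have "(emeasure \<mu> N)\<^sup>2 * ?\<omega> \<le> (emeasure \<mu> W)\<^sup>2 * ?\<omega>"
      using W by (intro mult_right_mono power_mono emeasure_mono) (auto simp: assms(2))
    also have "\<dots> \<le> emeasure lborel W * ennreal L" by (rule U[OF W(1)])
    also have "emeasure lborel W = emeasure lborel (W - N)"
      using N W by (simp add: emeasure_Diff_null_set)
    also have "\<dots> * ennreal L \<le> ennreal (e / L) * ennreal L"
      using W(3) by (intro mult_right_mono) auto
    also have "\<dots> = ennreal e"
      using L that by (simp flip: ennreal_mult)
    finally show ?thesis .
  qed
  have "(emeasure \<mu> N)\<^sup>2 * ?\<omega> \<le> 0"
  proof (rule ennreal_le_epsilon)
    show "(emeasure \<mu> N)\<^sup>2 * ?\<omega> \<le> 0 + ennreal e" if "0 < e" for e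
      using small[OF that] by simp
  qed
  then have "(emeasure \<mu> N)\<^sup>2 = 0 \<or> ?\<omega> = 0"
    by (simp only: le_zero_eq mult_eq_0_iff)
  moreover have "?\<omega> \<noteq> 0"
    by (simp add: ennreal_eq_0_iff not_le)
  ultimately have "emeasure \<mu> N = 0" by simp
  then show ?thesis using N'(1) assms(2) by (auto simp: null_sets_def)
qed

section \<open>Hypersurfaces\<close>

text \<open>The hypersurface is the image of a hyperplane, which is negligible, under a Lipschitz
  map into the same space. As \<open>negligible\<close> refers to the completed measure, closedness
  is proved as well, to make the set Borel.\<close>

lemma dc_hypersurface_null:
  fixes A :: "'v::euclidean_space set"
  assumes "dc_hypersurface A"
  shows "A \<in> null_sets lborel"
proof -
  obtain v :: 'v and f g L1 L2 where v: "v \<noteq> 0"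
    and f: "L1-lipschitz_on (orthogonal_comp {v}) f" and g: "L2-lipschitz_on (orthogonal_comp {v}) g"
    and A: "A = (\<lambda>x. x + (f x - g x) *\<^sub>R v) ` orthogonal_comp {v}"
    using assms unfolding dc_hypersurface_def by auto
  let ?H = "orthogonal_comp {v}"
  have H: "?H = {x. v \<bullet> x = 0}"
    by (auto simp: orthogonal_comp_def orthogonal_def)
  have "negligible A"
    unfolding A
  proof (rule negligible_locally_Lipschitz_image)
    show "negligible ?H"
      unfolding H using v by (intro negligible_hyperplane) auto
    fix x assume x: "x \<in> ?H"
    have "norm (y + (f y - g y) *\<^sub>R v - (x + (f x - g x) *\<^sub>R v)) \<le> (1 + (L1 + L2) * norm v) * norm (y - x)"
      if y: "y \<in> ?H" for y
    proof -
      have "norm (y + (f y - g y) *\<^sub>R v - (x + (f x - g x) *\<^sub>R v))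
          = norm ((y - x) + ((f y - f x) - (g y - g x)) *\<^sub>R v)"
        by (simp add: algebra_simps)
      also have "\<dots> \<le> norm (y - x) + \<bar>(f y - f x) - (g y - g x)\<bar> * norm v"
        by (rule norm_triangle_le) simp
      also have "\<dots> \<le> norm (y - x) + (L1 * norm (y - x) + L2 * norm (y - x)) * norm v"
        using lipschitz_onD[OF f y x] lipschitz_onD[OF g y x]
        by (intro add_left_mono mult_right_mono) (auto simp: dist_norm)
      finally show ?thesis by (simp add: algebra_simps)
    qed
    then show "\<exists>T B. open T \<and> x \<in> T \<and> (\<forall>y\<in>?H \<inter> T.
        norm (y + (f y - g y) *\<^sub>R v - (x + (f x - g x) *\<^sub>R v)) \<le> B * norm (y - x))"
      by (intro exI[of _ UNIV]) auto
  qed simp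
  moreover have "closed A"
  proof -
    \<comment> \<open>\<open>p\<close> is the orthogonal projection onto the hyperplane. The
      hypersurface is described by an equation between continuous functions: the coordinate along
      \<open>v\<close> equals \<open>f - g\<close> at the projected point.\<close>
    define p where "p y = y - ((v \<bullet> y) / (v \<bullet> v)) *\<^sub>R v" for y
    have p: "p y \<in> ?H" for y
      using v by (simp add: H p_def inner_diff_right)
    have cp: "continuous_on UNIV p"
      unfolding p_def using v by (intro continuous_intros) auto
    have "continuous_on UNIV (\<lambda>y. f (p y))" "continuous_on UNIV (\<lambda>y. g (p y))"
      by (rule continuous_on_compose2[OF lipschitz_on_continuous_on[OF f] cp], use p in auto)
         (rule continuous_on_compose2[OF lipschitz_on_continuous_on[OF g] cp], use p in auto)
    then have "closed {y. (v \<bullet> y) / (v \<bullet> v) = f (p y) - g (p y)}"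
      using v by (intro closed_Collect_eq continuous_intros) auto
    moreover have "A = {y. (v \<bullet> y) / (v \<bullet> v) = f (p y) - g (p y)}"
    proof (intro set_eqI iffI)
      fix y assume "y \<in> A"
      then obtain x where x: "x \<in> ?H" "y = x + (f x - g x) *\<^sub>R v" by (auto simp: A)
      then have "(v \<bullet> y) / (v \<bullet> v) = f x - g x"
        using v by (simp add: H inner_add_right)
      moreover from this x have "p y = x" by (simp add: p_def)
      ultimately show "y \<in> {y. (v \<bullet> y) / (v \<bullet> v) = f (p y) - g (p y)}" by simp
    next
      fix y assume "y \<in> {y. (v \<bullet> y) / (v \<bullet> v) = f (p y) - g (p y)}"
      then have "y = p y + (f (p y) - g (p y)) *\<^sub>R v" by (simp add: p_def)
      then show "y \<in> A" unfolding A using p by blast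
    qed
    ultimately show ?thesis by simp
  qed
  ultimately show ?thesis
    by (simp add: negligible_iff_null_sets null_sets_completion_iff)
qed

section \<open>Gaussian laws\<close>

lemma (in prob_space) char_distr_normal:
  assumes "0 < \<sigma>" "distributed M lborel X (normal_density 0 \<sigma>)"
  shows "char (distr M borel X) t = of_real (exp (- (\<sigma>\<^sup>2 * t\<^sup>2 / 2)))"
proof -
  have X[measurable]: "X \<in> borel_measurable M"
    using distributed_measurable[OF assms(2)] by simp
  have "distributed M lborel (\<lambda>x. (X x - 0) / \<sigma>) std_normal_density"
    using normal_standard_normal_convert[OF assms(1)] assms(2) by blast
  then have "distr M lborel (\<lambda>x. X x / \<sigma>) = std_normal_distribution"
    by (simp add: distributed_distr_eq_density)
  moreover have "distr M lborel (\<lambda>x. X x / \<sigma>) = distr M borel (\<lambda>x. X x / \<sigma>)"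
    by (rule distr_cong) auto
  ultimately have d: "distr M borel (\<lambda>x. X x / \<sigma>) = std_normal_distribution" by simp
  have "char (distr M borel X) t = char (distr M borel (\<lambda>x. X x / \<sigma>)) (\<sigma> * t)"
    using assms(1) by (simp add: char_def integral_distr mult.commute)
  also have "\<dots> = of_real (exp (- (\<sigma>\<^sup>2 * t\<^sup>2 / 2)))"
    unfolding d char_std_normal_distribution by (simp add: power_mult_distrib)
  finally show ?thesis .
qed

lemma real_distribution_density_normal:
  assumes "\<sigma> > 0"
  shows "real_distribution (density lborel (normal_density \<mu> \<sigma>))"
  using prob_space_normal_density[OF assms, of \<mu>]
  by (simp add: real_distribution_def real_distribution_axioms_def)

lemma char_density_normal:
  assumes "\<sigma> > 0"
  shows "char (density lborel (normal_density 0 \<sigma>)) t = of_real (exp (- (\<sigma>\<^sup>2 * t\<^sup>2 / 2)))"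
proof -
  let ?N = "density lborel (normal_density 0 \<sigma>)"
  interpret N: prob_space ?N by (rule prob_space_normal_density[OF assms])
  have d: "distr ?N lborel (\<lambda>x. x) = ?N" "distr ?N borel (\<lambda>x. x) = ?N"
    by (auto intro!: distr_id2)
  have "distributed ?N lborel (\<lambda>x. x) (normal_density 0 \<sigma>)"
    by (simp add: distributed_def d)
  from N.char_distr_normal[OF assms this] show ?thesis
    by (simp add: d)
qed

lemma (in prob_space) char_centered_normal:
  assumes "sym_pos_def S" "centered_normal M X S"
  shows "char (distr M borel (\<lambda>\<omega>. X \<omega> \<bullet> u)) t = of_real (exp (- (t\<^sup>2 * ((S *v u) \<bullet> u) / 2)))"
proof (cases "u = 0")
  \<comment> \<open>\<open>centered_normal\<close> says nothing about the zero vector. The variable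
    is then constantly 0, and both sides equal 1.\<close>
  case True
  then show ?thesis
    by (simp add: char_def integral_distr prob_space del: distr_const)
next
  case False
  then have p: "0 < (S *v u) \<bullet> u"
    using assms(1) by (auto simp: sym_pos_def_def)
  have "distributed M lborel (\<lambda>\<omega>. X \<omega> \<bullet> u) (normal_density 0 (sqrt ((S *v u) \<bullet> u)))"
    using assms(2) False by (auto simp: centered_normal_def)
  from char_distr_normal[OF _ this, of t] p show ?thesis
    by (simp add: mult.commute)
qed

text \<open>Characteristic functions are preferred to densities because some of the vectors
  \<open>u n\<close>, or all of them, may vanish, and the corresponding summands then have no
  density.\<close>

lemma (in prob_space) char_sum_centered_normal:
  fixes \<xi> :: "nat \<Rightarrow> 'a \<Rightarrow> real^'d"
  assumes "\<And>n. sym_pos_def (S n)" "\<And>n. centered_normal M (\<xi> n) (S n)"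
    and "indep_vars (\<lambda>_. borel) \<xi> UNIV"
  shows "char (distr M borel (\<lambda>\<omega>. \<Sum>n<N. \<xi> n \<omega> \<bullet> u n)) t
    = of_real (exp (- (t\<^sup>2 * (\<Sum>n<N. (S n *v u n) \<bullet> u n) / 2)))"
proof -
  have "indep_vars (\<lambda>_. borel) (\<lambda>n \<omega>. \<xi> n \<omega> \<bullet> u n) {..<N}"
    by (rule indep_vars_subset[OF indep_vars_compose2[OF assms(3)]]) auto
  then have "char (distr M borel (\<lambda>\<omega>. \<Sum>n<N. \<xi> n \<omega> \<bullet> u n)) t
      = (\<Prod>n<N. char (distr M borel (\<lambda>\<omega>. \<xi> n \<omega> \<bullet> u n)) t)"
    by (rule char_distr_sum)
  also have "\<dots> = (\<Prod>n<N. of_real (exp (- (t\<^sup>2 * ((S n *v u n) \<bullet> u n) / 2))))"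
    using assms by (intro prod.cong refl char_centered_normal) auto
  also have "\<dots> = of_real (exp (\<Sum>n<N. - (t\<^sup>2 * ((S n *v u n) \<bullet> u n) / 2)))"
    by (simp add: exp_sum)
  also have "(\<Sum>n<N. - (t\<^sup>2 * ((S n *v u n) \<bullet> u n) / 2)) = - (t\<^sup>2 * (\<Sum>n<N. (S n *v u n) \<bullet> u n) / 2)"
    by (simp add: sum_negf sum_distrib_left sum_divide_distrib)
  finally show ?thesis .
qed

lemma (in prob_space) centered_normal_second_moment:
  fixes X :: "'a \<Rightarrow> real^'d"
  assumes "sym_pos_def S" "centered_normal M X S"
  shows "(\<integral>\<^sup>+\<omega>. ennreal ((norm (X \<omega>))\<^sup>2) \<partial>M) < \<infinity>"
proof -
  have [measurable]: "X \<in> borel_measurable M"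
    using assms(2) by (simp add: centered_normal_def)
  have comp: "(\<integral>\<^sup>+\<omega>. ennreal ((X \<omega> \<bullet> axis i 1)\<^sup>2) \<partial>M) < \<infinity>" for i
  proof -
    define \<sigma> where "\<sigma> = sqrt ((S *v axis i 1) \<bullet> axis i 1)"
    have ne: "(axis i 1 :: real^'d) \<noteq> 0" by (simp add: axis_eq_0_iff)
    then have "\<sigma> > 0" using assms(1) by (auto simp: sym_pos_def_def \<sigma>_def)
    have d: "distributed M lborel (\<lambda>\<omega>. X \<omega> \<bullet> axis i 1) (normal_density 0 \<sigma>)"
      using assms(2) ne by (auto simp: centered_normal_def \<sigma>_def)
    have "(\<integral>\<^sup>+\<omega>. ennreal ((X \<omega> \<bullet> axis i 1)\<^sup>2) \<partial>M)
        = (\<integral>\<^sup>+x. ennreal (normal_density 0 \<sigma> x) * ennreal (x\<^sup>2) \<partial>lborel)"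
      by (rule distributed_nn_integral[OF d, symmetric]) simp
    also have "\<dots> = (\<integral>\<^sup>+x. ennreal (normal_density 0 \<sigma> x * (x - 0) ^ 2) \<partial>lborel)"
      by (simp add: ennreal_mult)
    also have "\<dots> < \<infinity>"
      by (subst nn_integral_eq_integral[OF integrable_normal_moment]) (use \<open>\<sigma> > 0\<close> in auto)
    finally show ?thesis .
  qed
  have "(\<integral>\<^sup>+\<omega>. ennreal ((norm (X \<omega>))\<^sup>2) \<partial>M) = (\<integral>\<^sup>+\<omega>. (\<Sum>i\<in>UNIV. ennreal ((X \<omega> \<bullet> axis i 1)\<^sup>2)) \<partial>M)"
    by (intro nn_integral_cong)
       (simp add: sum_ennreal norm_vec_def L2_set_def sum_nonneg inner_axis)
  also have "\<dots> = (\<Sum>i\<in>UNIV. \<integral>\<^sup>+\<omega>. ennreal ((X \<omega> \<bullet> axis i 1)\<^sup>2) \<partial>M)"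
    by (rule nn_integral_sum) measurable
  also have "\<dots> < \<infinity>"
    using comp by (simp add: less_top)
  finally show ?thesis .
qed

section \<open>Gaussian small-ball estimate\<close>

lemma integral_std_normal_exp_square:
  assumes "c \<ge> 0"
  shows "integrable std_normal_distribution (\<lambda>x. exp (- (c * x\<^sup>2 / 2)))" (is ?int)
    and "(\<integral>x. exp (- (c * x\<^sup>2 / 2)) \<partial>std_normal_distribution) = 1 / sqrt (1 + c)"
proof -
  interpret prob_space std_normal_distribution
    by (rule prob_space_normal_density) simp
  show ?int
    by (rule integrable_const_bound[where B=1]) (use assms in auto)
  \<comment> \<open>The exponential raises the inverse variance from 1 to 1 + c, so the product is
    again a centered normal density up to normalization.\<close>
  have eq: "std_normal_density x * exp (- (c * x\<^sup>2 / 2)) = 1 / sqrt (1 + c) * normal_density 0 (1 / sqrt (1 + c)) x" for x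
    using assms
    by (simp add: normal_density_def real_sqrt_divide real_sqrt_mult power_divide field_simps flip: exp_add)
  have "(\<integral>x. exp (- (c * x\<^sup>2 / 2)) \<partial>std_normal_distribution)
      = (\<integral>x. std_normal_density x * exp (- (c * x\<^sup>2 / 2)) \<partial>lborel)"
    by (subst integral_density) auto
  also have "\<dots> = 1 / sqrt (1 + c) * (\<integral>x. normal_density 0 (1 / sqrt (1 + c)) x \<partial>lborel)"
    unfolding eq by simp
  also have "\<dots> = 1 / sqrt (1 + c)"
    using assms by simp
  finally show "(\<integral>x. exp (- (c * x\<^sup>2 / 2)) \<partial>std_normal_distribution) = 1 / sqrt (1 + c)" .
qed

text \<open>Up to a factor, the indicator of a ball is bounded by a Gaussian, which is itself the
  characteristic function of a standard normal vector \<open>g\<close>. Exchanging the two expectations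
  leaves the characteristic function of \<open>Z\<close>, evaluated at multiples of \<open>g\<close>.\<close>

lemma (in prob_space) small_ball_estimate:
  fixes Z :: "'a \<Rightarrow> real^'d"
  assumes [measurable]: "Z \<in> borel_measurable M" and "\<rho> > 0" "a \<ge> 0"
    and char: "\<And>u. char (distr M borel (\<lambda>\<omega>. Z \<omega> \<bullet> u)) 1 = of_real (exp (- (V u / 2)))"
    and V: "\<And>u. a * (norm u)\<^sup>2 \<le> V u"
  shows "(\<integral>\<^sup>+\<omega>. indicator {..<\<rho>} (norm (Z \<omega>)) \<partial>M)
      \<le> ennreal (exp (1 / 2) * (1 / sqrt (1 + a / \<rho>\<^sup>2)) ^ CARD('d))"
proof -
  define N where "N = Pi\<^sub>M (UNIV :: 'd set) (\<lambda>_. std_normal_distribution)"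
  interpret S: prob_space std_normal_distribution
    by (rule prob_space_normal_density) simp
  interpret N: prob_space N
    unfolding N_def by (rule prob_space_PiM) (rule S.prob_space_axioms)
  interpret MN: pair_prob_space M N ..
  interpret fin: product_sigma_finite "\<lambda>_::'d. std_normal_distribution" ..
  \<comment> \<open>A standard normal vector divided by \<open>\<rho>\<close>; its characteristic
    function at z is exp(-|z|^2 / (2 \<rho>^2)), a Gaussian profile at the scale of the
    ball.\<close>
  define u where "u g = (\<chi> i. g i / \<rho>)" for g :: "'d \<Rightarrow> real"
  have N_comp [measurable]: "(\<lambda>g. g i) \<in> borel_measurable N" for i
    unfolding N_def by measurable
  have inner_u: "z \<bullet> u g = (\<Sum>i\<in>UNIV. z $ i * g i / \<rho>)" for z g
    by (simp add: u_def inner_vec_def)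
  have inner_meas [measurable]: "(\<lambda>(\<omega>, g). Z \<omega> \<bullet> u g) \<in> borel_measurable (M \<Otimes>\<^sub>M N)"
  proof -
    have [measurable]: "(\<lambda>x. snd x i) \<in> borel_measurable (M \<Otimes>\<^sub>M N)" for i
      by (rule measurable_compose[OF measurable_snd N_comp])
    have "(\<lambda>\<omega>. Z \<omega> \<bullet> axis i 1) \<in> borel_measurable M" for i
      by measurable
    then have [measurable]: "(\<lambda>x. Z (fst x) $ i) \<in> borel_measurable (M \<Otimes>\<^sub>M N)" for i
      by (auto simp: cart_eq_inner_axis intro: measurable_compose[OF measurable_fst])
    show ?thesis
      unfolding inner_u split_beta
      by (intro borel_measurable_sum borel_measurable_divide borel_measurable_times) auto
  qed
  have gauss: "(\<integral>g. iexp (z \<bullet> u g) \<partial>N) = of_real (exp (- ((norm z)\<^sup>2 / (2 * \<rho>\<^sup>2))))" for z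
  proof -
    have "(\<integral>g. iexp (z \<bullet> u g) \<partial>N) = (\<integral>g. (\<Prod>i\<in>UNIV. iexp (z $ i / \<rho> * g i)) \<partial>N)"
      by (simp add: inner_u sum_distrib_left mult_ac flip: exp_sum)
    also have "\<dots> = (\<Prod>i\<in>UNIV. char std_normal_distribution (z $ i / \<rho>))"
      unfolding N_def char_def
      by (rule fin.product_integral_prod) (auto intro!: S.integrable_const_bound[where B=1])
    also have "\<dots> = of_real (exp (\<Sum>i\<in>UNIV. - ((z $ i / \<rho>)\<^sup>2 / 2)))"
      by (simp add: char_std_normal_distribution exp_sum)
    also have "(\<Sum>i\<in>UNIV. - ((z $ i / \<rho>)\<^sup>2 / 2)) = - ((norm z)\<^sup>2 / (2 * \<rho>\<^sup>2))"
      by (simp add: norm_vec_def L2_set_def sum_nonneg sum_negf power_divide sum_divide_distrib mult.commute)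
    finally show ?thesis .
  qed
  have "of_real (\<integral>\<omega>. exp (- ((norm (Z \<omega>))\<^sup>2 / (2 * \<rho>\<^sup>2))) \<partial>M)
      = (\<integral>\<omega>. (\<integral>g. iexp (Z \<omega> \<bullet> u g) \<partial>N) \<partial>M)"
    by (simp add: gauss)
  also have "\<dots> = (\<integral>g. (\<integral>\<omega>. iexp (Z \<omega> \<bullet> u g) \<partial>M) \<partial>N)"
    by (rule MN.Fubini_integral[symmetric]) (auto intro!: MN.P.integrable_const_bound[where B=1])
  also have "\<dots> = (\<integral>g. of_real (exp (- (V (u g) / 2))) \<partial>N)"
    using char by (intro Bochner_Integration.integral_cong) (auto simp: char_def integral_distr)
  also have "\<dots> = of_real (\<integral>g. exp (- (V (u g) / 2)) \<partial>N)"
    by simp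
  finally have eq: "(\<integral>\<omega>. exp (- ((norm (Z \<omega>))\<^sup>2 / (2 * \<rho>\<^sup>2))) \<partial>M) = (\<integral>g. exp (- (V (u g) / 2)) \<partial>N)"
    by (simp only: of_real_eq_iff)
  \<comment> \<open>The lower bound on \<open>V\<close> gives an integrand that factorizes over the
    coordinates of \<open>g\<close>; each coordinate then contributes 1 / sqrt (1 + a /
    \<rho>^2).\<close>
  also have "\<dots> \<le> (\<integral>g. (\<Prod>i\<in>UNIV. exp (- (a / \<rho>\<^sup>2 * (g i)\<^sup>2 / 2))) \<partial>N)"
  proof (rule integral_mono')
    show "integrable N (\<lambda>g. \<Prod>i\<in>UNIV. exp (- (a / \<rho>\<^sup>2 * (g i)\<^sup>2 / 2)))"
      unfolding N_def
      using assms(2,3) by (intro fin.product_integrable_prod integral_std_normal_exp_square) auto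
    fix g
    have "(\<Sum>i\<in>UNIV. a / \<rho>\<^sup>2 * (g i)\<^sup>2 / 2) = a * (norm (u g))\<^sup>2 / 2"
      by (simp add: norm_vec_def L2_set_def sum_nonneg u_def power_divide sum_distrib_left sum_divide_distrib)
    then have "(\<Sum>i\<in>UNIV. a / \<rho>\<^sup>2 * (g i)\<^sup>2 / 2) \<le> V (u g) / 2"
      using V[of "u g"] by simp
    then show "exp (- (V (u g) / 2)) \<le> (\<Prod>i\<in>UNIV. exp (- (a / \<rho>\<^sup>2 * (g i)\<^sup>2 / 2)))"
      by (simp add: sum_negf flip: exp_sum)
  qed (auto intro!: prod_nonneg)
  also have "\<dots> = (1 / sqrt (1 + a / \<rho>\<^sup>2)) ^ CARD('d)"
    unfolding N_def using integral_std_normal_exp_square[of "a / \<rho>\<^sup>2"] assms(2,3)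
    by (subst fin.product_integral_prod) simp_all
  finally have le: "(\<integral>\<omega>. exp (- ((norm (Z \<omega>))\<^sup>2 / (2 * \<rho>\<^sup>2))) \<partial>M) \<le> (1 / sqrt (1 + a / \<rho>\<^sup>2)) ^ CARD('d)" .
  \<comment> \<open>Inside the ball the Gaussian profile is at least exp(-1/2), which explains the
    constant \<open>exp (1 / 2)\<close>.\<close>
  have "(\<integral>\<^sup>+\<omega>. indicator {..<\<rho>} (norm (Z \<omega>)) \<partial>M)
      \<le> (\<integral>\<^sup>+\<omega>. ennreal (exp (1 / 2) * exp (- ((norm (Z \<omega>))\<^sup>2 / (2 * \<rho>\<^sup>2)))) \<partial>M)"
  proof (rule nn_integral_mono)
    fix \<omega>
    have "1 \<le> exp (1 / 2) * exp (- ((norm (Z \<omega>))\<^sup>2 / (2 * \<rho>\<^sup>2)))" if "norm (Z \<omega>) < \<rho>"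
    proof -
      have "(norm (Z \<omega>))\<^sup>2 \<le> \<rho>\<^sup>2" using that by (intro power_mono) auto
      then show ?thesis using assms(2) by (simp add: field_simps flip: exp_add)
    qed
    then show "(indicator {..<\<rho>} (norm (Z \<omega>)) :: ennreal)
        \<le> ennreal (exp (1 / 2) * exp (- ((norm (Z \<omega>))\<^sup>2 / (2 * \<rho>\<^sup>2))))"
      by (auto simp: indicator_def simp flip: ennreal_1 intro!: ennreal_leI)
  qed
  also have "\<dots> = ennreal (\<integral>\<omega>. exp (1 / 2) * exp (- ((norm (Z \<omega>))\<^sup>2 / (2 * \<rho>\<^sup>2))) \<partial>M)"
  proof (rule nn_integral_eq_integral)
    have "integrable M (\<lambda>\<omega>. exp (- ((norm (Z \<omega>))\<^sup>2 / (2 * \<rho>\<^sup>2))))"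
      by (rule integrable_const_bound[where B=1]) auto
    then show "integrable M (\<lambda>\<omega>. exp (1 / 2) * exp (- ((norm (Z \<omega>))\<^sup>2 / (2 * \<rho>\<^sup>2))))"
      by simp
  qed simp
  also have "\<dots> \<le> ennreal (exp (1 / 2) * (1 / sqrt (1 + a / \<rho>\<^sup>2)) ^ CARD('d))"
    using le by (intro ennreal_leI) simp
  finally show ?thesis .
qed

section \<open>Functionals on $L^2$\<close>

lemma L2_functional_class:
  fixes l :: "('q \<Rightarrow> 'v::euclidean_space) set \<Rightarrow> real"
  assumes "L2_functional Q l"
  shows L2_functional_class_add: "f \<in> L2_fun Q \<Longrightarrow> g \<in> L2_fun Q \<Longrightarrow>
      l (L2_class Q (\<lambda>q. f q + g q)) = l (L2_class Q f) + l (L2_class Q g)"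
    and L2_functional_class_scale: "f \<in> L2_fun Q \<Longrightarrow>
      l (L2_class Q (\<lambda>q. c *\<^sub>R f q)) = c * l (L2_class Q f)"
proof -
  assume f: "f \<in> L2_fun Q"
  have "L2_scale Q c (L2_class Q f) = L2_class Q (\<lambda>q. c *\<^sub>R f q)"
    unfolding L2_scale_def by (rule L2_class_cong_AE) (use L2_rep_class(2)[OF f] in auto)
  then show "l (L2_class Q (\<lambda>q. c *\<^sub>R f q)) = c * l (L2_class Q f)"
    using assms L2_class_in_L2[OF f] by (metis L2_functional_def)
  assume g: "g \<in> L2_fun Q"
  have "L2_add Q (L2_class Q f) (L2_class Q g) = L2_class Q (\<lambda>q. f q + g q)"
    unfolding L2_add_def
    by (rule L2_class_cong_AE) (use L2_rep_class(2)[OF f] L2_rep_class(2)[OF g] in auto)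
  then show "l (L2_class Q (\<lambda>q. f q + g q)) = l (L2_class Q f) + l (L2_class Q g)"
    using assms L2_class_in_L2[OF f] L2_class_in_L2[OF g] by (metis L2_functional_def)
qed

lemma L2_functional_class_sum:
  fixes l :: "('q \<Rightarrow> 'v::euclidean_space) set \<Rightarrow> real"
  assumes "L2_functional Q l" "\<And>i. i \<in> I \<Longrightarrow> f i \<in> L2_fun Q"
  shows "l (L2_class Q (\<lambda>q. \<Sum>i\<in>I. f i q)) = (\<Sum>i\<in>I. l (L2_class Q (f i)))"
proof -
  have zero: "l (L2_class Q (\<lambda>q. 0)) = 0"
    using L2_functional_class_scale[OF assms(1) L2_fun_0, of 0] by simp
  show ?thesis
    using assms(2)
  proof (induction I rule: infinite_finite_induct)
    case (insert i I)
    then show ?case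
      using L2_functional_class_add[OF assms(1), of "f i" "\<lambda>q. \<Sum>i\<in>I. f i q"]
      by (simp add: L2_fun_sum)
  qed (simp_all add: zero)
qed

lemma L2_functional_Lipschitz:
  fixes l :: "('q \<Rightarrow> 'v::euclidean_space) set \<Rightarrow> real"
  assumes "L2_functional Q l"
  obtains C where "C \<ge> 0" "\<And>X Y. X \<in> L2 Q \<Longrightarrow> Y \<in> L2 Q \<Longrightarrow> \<bar>l X - l Y\<bar> \<le> C * L2_dist Q X Y"
    "\<And>X. X \<in> L2 Q \<Longrightarrow> \<bar>l X\<bar> \<le> C * L2_norm Q X"
proof -
  obtain C where C: "\<forall>X\<in>L2 Q. \<bar>l X\<bar> \<le> C * L2_norm Q X"
    using assms by (auto simp: L2_functional_def)
  have C': "\<bar>l X\<bar> \<le> \<bar>C\<bar> * L2_norm Q X" if "X \<in> L2 Q" for X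
  proof -
    have "0 \<le> L2_norm Q X" by (simp add: L2_norm_def integral_nonneg_AE)
    then have "C * L2_norm Q X \<le> \<bar>C\<bar> * L2_norm Q X"
      by (intro mult_right_mono) auto
    with C that show ?thesis by force
  qed
  show thesis
  proof (rule that[of "\<bar>C\<bar>"])
    fix X Y :: "('q \<Rightarrow> 'v) set" assume XY: "X \<in> L2 Q" "Y \<in> L2 Q"
    note X = L2_rep_L2[OF XY(1)] and Y = L2_rep_L2[OF XY(2)]
    have "l (L2_class Q (\<lambda>q. L2_rep X q - L2_rep Y q)) = l X - l Y"
      using L2_functional_class_add[OF assms X(1) L2_fun_scale[OF Y(1), of "-1"]]
        L2_functional_class_scale[OF assms Y(1), of "-1"] by (simp add: X Y)
    moreover have "L2_norm Q (L2_class Q (\<lambda>q. L2_rep X q - L2_rep Y q)) = L2_dist Q X Y"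
      by (simp add: L2_norm_class L2_fun_diff X Y L2_dist_def)
    ultimately show "\<bar>l X - l Y\<bar> \<le> \<bar>C\<bar> * L2_dist Q X Y"
      using C'[OF L2_class_in_L2[OF L2_fun_diff[OF X(1) Y(1)]]] by simp
  qed (use C' in auto)
qed

lemma L2_functional_measurable:
  assumes "L2_functional Q l"
  shows "l \<in> borel_measurable (L2_borel Q)"
proof -
  obtain C where "C \<ge> 0" "\<And>X Y. X \<in> L2 Q \<Longrightarrow> Y \<in> L2 Q \<Longrightarrow> \<bar>l X - l Y\<bar> \<le> C * L2_dist Q X Y"
    using L2_functional_Lipschitz[OF assms] by metis
  then show ?thesis
    unfolding L2_borel_def
    by (intro Lipschitz_borel_measurable_metric_borel[of C]) (auto simp: dist_real_def)
qed

text \<open>Completeness is given for scalar functions. Each coordinate of a representative is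
  therefore approximated separately by combinations of the \<open>E n\<close>, and continuity of
  \<open>l\<close> shows that every coordinate contributes 0.\<close>

lemma L2_functional_eq_0I:
  fixes l :: "('q \<Rightarrow> real^'d) set \<Rightarrow> real"
  assumes l: "L2_functional Q l" and E: "complete_orthonormal_system Q E"
    and zero: "\<And>n i. l (L2_class Q (\<lambda>q. E n q *\<^sub>R axis i 1)) = 0"
    and "X \<in> L2 Q"
  shows "l X = 0"
proof -
  obtain C where C: "C \<ge> 0" "\<And>X Y. X \<in> L2 Q \<Longrightarrow> Y \<in> L2 Q \<Longrightarrow> \<bar>l X - l Y\<bar> \<le> C * L2_dist Q X Y"
    using L2_functional_Lipschitz[OF l] by metis
  have En: "E n \<in> L2_fun Q" for n
    using E by (auto simp: complete_orthonormal_system_def)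
  have dense: "\<exists>N c. (\<integral>q. (f q - (\<Sum>n<N. c n * E n q))\<^sup>2 \<partial>Q) < e"
    if "f \<in> L2_fun Q" "e > 0" for f :: "'q \<Rightarrow> real" and e
    using E that by (simp add: complete_orthonormal_system_def)
  let ?f = "\<lambda>i q. L2_rep X q \<bullet> axis i 1"
  have f: "?f i \<in> L2_fun Q" for i
    by (rule L2_fun_inner[OF L2_rep_L2(1)[OF \<open>X \<in> L2 Q\<close>]])
  have comp: "l (L2_class Q (\<lambda>q. ?f i q *\<^sub>R axis i 1)) = 0" for i
  proof -
    let ?a = "\<bar>l (L2_class Q (\<lambda>q. ?f i q *\<^sub>R axis i 1))\<bar>"
    have small: "?a \<le> C * e" if "e > 0" for e
    proof -
      obtain N c where c: "(\<integral>q. (?f i q - (\<Sum>n<N. c n * E n q))\<^sup>2 \<partial>Q) < e\<^sup>2"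
        using dense[OF f[of i] zero_less_power[OF \<open>e > 0\<close>, of 2]] by blast
      let ?h = "\<lambda>q. \<Sum>n<N. c n *\<^sub>R (E n q *\<^sub>R axis i 1 :: real^'d)"
      have Ei: "(\<lambda>q. E n q *\<^sub>R axis i 1 :: real^'d) \<in> L2_fun Q" for n
        by (rule L2_fun_scale_right[OF En])
      have h: "?h \<in> L2_fun Q"
        by (intro L2_fun_sum L2_fun_scale Ei)
      have "l (L2_class Q ?h) = 0"
        using L2_functional_class_sum[OF l, of "{..<N}" "\<lambda>n q. c n *\<^sub>R (E n q *\<^sub>R axis i 1)"]
        by (simp add: L2_fun_scale[OF Ei] L2_functional_class_scale[OF l Ei] zero del: scaleR_scaleR)
      then have "?a \<le> C * L2_dist Q (L2_class Q (\<lambda>q. ?f i q *\<^sub>R axis i 1)) (L2_class Q ?h)"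
        using C(2)[OF L2_class_in_L2[OF L2_fun_scale_right[OF f]] L2_class_in_L2[OF h]] by fastforce
      also have "L2_dist Q (L2_class Q (\<lambda>q. ?f i q *\<^sub>R axis i 1)) (L2_class Q ?h)
          = sqrt (\<integral>q. (?f i q - (\<Sum>n<N. c n * E n q))\<^sup>2 \<partial>Q)"
      proof -
        have "norm (?f i q *\<^sub>R axis i 1 - ?h q) = \<bar>?f i q - (\<Sum>n<N. c n * E n q)\<bar>" for q
        proof -
          have "?f i q *\<^sub>R axis i 1 - ?h q = (?f i q - (\<Sum>n<N. c n * E n q)) *\<^sub>R axis i 1"
            by (simp add: scaleR_left_diff_distrib scaleR_left.sum)
          then show ?thesis by simp
        qed
        then show ?thesis
          by (simp add: L2_dist_class L2_fun_scale_right f h del: scaleR_scaleR)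
      qed
      also have "\<dots> \<le> e"
        using c that by (intro real_le_lsqrt) auto
      finally show ?thesis using C(1) by (simp add: mult_left_mono)
    qed
    have "?a \<le> 0"
    proof (rule field_le_epsilon)
      fix e :: real assume "e > 0"
      \<comment> \<open>The denominator is \<open>C + 1\<close> because \<open>C\<close> may be
        0.\<close>
      have "?a \<le> C * (e / (C + 1))"
        using \<open>e > 0\<close> C(1) by (intro small) auto
      also have "\<dots> \<le> e" using \<open>e > 0\<close> C(1) by (simp add: field_simps)
      finally show "?a \<le> 0 + e" by simp
    qed
    then show ?thesis by simp
  qed
  have "L2_rep X q = (\<Sum>i\<in>UNIV. ?f i q *\<^sub>R axis i 1)" for q
    using basis_expansion[of "L2_rep X q"] by (simp add: inner_axis scalar_mult_eq_scaleR)
  then have "L2_rep X = (\<lambda>q. \<Sum>i\<in>UNIV. ?f i q *\<^sub>R axis i 1)"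
    by (rule ext)
  from arg_cong[OF this, of "\<lambda>f. l (L2_class Q f)"]
  have "l X = l (L2_class Q (\<lambda>q. \<Sum>i\<in>UNIV. ?f i q *\<^sub>R axis i 1))"
    by (simp only: L2_rep_L2(2)[OF \<open>X \<in> L2 Q\<close>])
  also have "\<dots> = 0"
    by (subst L2_functional_class_sum[OF l]) (auto intro!: L2_fun_scale_right f simp: comp)
  finally show ?thesis .
qed

section \<open>Limits\<close>

text \<open>The characters are 1-Lipschitz, so the difference of the two characteristic functions is
  at most a first moment. The elementary bound d <= \<delta> + d^2 / \<delta> reduces it to the
  second moment, which is the quantity assumed to vanish.\<close>

lemma (in prob_space) char_tendsto_of_L2:
  fixes X :: "'a \<Rightarrow> real" and Y :: "nat \<Rightarrow> 'a \<Rightarrow> real"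
  assumes [measurable]: "X \<in> borel_measurable M" "\<And>N. Y N \<in> borel_measurable M"
    and lim: "(\<lambda>N. \<integral>\<^sup>+\<omega>. ennreal ((X \<omega> - Y N \<omega>)\<^sup>2) \<partial>M) \<longlonglongrightarrow> 0"
  shows "(\<lambda>N. char (distr M borel (Y N)) t) \<longlonglongrightarrow> char (distr M borel X) t"
proof (rule tendstoI)
  fix e :: real assume "e > 0"
  define \<delta> where "\<delta> = e / 3"
  have "\<delta> > 0" using \<open>e > 0\<close> by (simp add: \<delta>_def)
  \<comment> \<open>With this \<open>c\<close>, the term t^2 c / \<delta> is at most \<delta>, and
    the total error is at most 2 \<delta>, less than e.\<close>
  define c where "c = \<delta>\<^sup>2 / (t\<^sup>2 + 1)"
  have "c > 0" using \<open>\<delta> > 0\<close> by (simp add: c_def add_nonneg_pos)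
  have "eventually (\<lambda>N. (\<integral>\<^sup>+\<omega>. ennreal ((X \<omega> - Y N \<omega>)\<^sup>2) \<partial>M) < ennreal c) sequentially"
    using order_tendstoD(2)[OF lim] \<open>c > 0\<close> by simp
  then show "eventually (\<lambda>N. dist (char (distr M borel (Y N)) t) (char (distr M borel X) t) < e) sequentially"
  proof eventually_elim
    case (elim N)
    have int: "integrable M (\<lambda>\<omega>. iexp (t * Z \<omega>))" if [measurable]: "Z \<in> borel_measurable M" for Z
      by (rule integrable_const_bound[where B=1]) auto
    have "char (distr M borel (Y N)) t - char (distr M borel X) t
        = (\<integral>\<omega>. iexp (t * Y N \<omega>) - iexp (t * X \<omega>) \<partial>M)"
      by (simp add: char_def integral_distr int[simplified])
    then have "ennreal (dist (char (distr M borel (Y N)) t) (char (distr M borel X) t))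
        = ennreal (norm (\<integral>\<omega>. iexp (t * Y N \<omega>) - iexp (t * X \<omega>) \<partial>M))"
      by (simp add: dist_norm)
    also have "\<dots> \<le> (\<integral>\<^sup>+\<omega>. ennreal (norm (iexp (t * Y N \<omega>) - iexp (t * X \<omega>))) \<partial>M)"
      by (intro integral_norm_bound_ennreal Bochner_Integration.integrable_diff int) auto
    also have "\<dots> \<le> (\<integral>\<^sup>+\<omega>. ennreal \<delta> + ennreal (t\<^sup>2 / \<delta>) * ennreal ((X \<omega> - Y N \<omega>)\<^sup>2) \<partial>M)"
    proof (rule nn_integral_mono)
      fix \<omega>
      let ?d = "\<bar>t * Y N \<omega> - t * X \<omega>\<bar>"
      have "norm (iexp (t * Y N \<omega>) - iexp (t * X \<omega>))
          = norm (iexp (t * X \<omega>) * (iexp (t * Y N \<omega> - t * X \<omega>) - 1))"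
        by (simp add: algebra_simps flip: exp_add)
      also have "\<dots> = norm (iexp (t * Y N \<omega> - t * X \<omega>) - 1)"
        by (simp only: norm_mult norm_exp_i_times mult_1)
      also have "\<dots> \<le> ?d"
        using iexp_approx1[of "t * Y N \<omega> - t * X \<omega>" 0] by simp
      also have "?d \<le> \<delta> + ?d\<^sup>2 / \<delta>"
      proof (cases "?d \<le> \<delta>")
        case False
        then have "?d * \<delta> \<le> ?d * ?d" by (intro mult_left_mono) auto
        then have "?d * \<delta> \<le> ?d\<^sup>2" by (simp only: power2_eq_square)
        then have "?d \<le> ?d\<^sup>2 / \<delta>" using \<open>\<delta> > 0\<close> by (simp add: pos_le_divide_eq)
        then show ?thesis using \<open>\<delta> > 0\<close> by linarith
      qed (use \<open>\<delta> > 0\<close> in \<open>auto intro: add_increasing2\<close>)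
      also have "?d\<^sup>2 = t\<^sup>2 * (X \<omega> - Y N \<omega>)\<^sup>2"
        by (simp add: power2_commute power_mult_distrib flip: right_diff_distrib)
      finally show "ennreal (norm (iexp (t * Y N \<omega>) - iexp (t * X \<omega>)))
          \<le> ennreal \<delta> + ennreal (t\<^sup>2 / \<delta>) * ennreal ((X \<omega> - Y N \<omega>)\<^sup>2)"
        using \<open>\<delta> > 0\<close> by (simp flip: ennreal_mult ennreal_plus add: ennreal_leI)
    qed
    also have "\<dots> = ennreal \<delta> + ennreal (t\<^sup>2 / \<delta>) * (\<integral>\<^sup>+\<omega>. ennreal ((X \<omega> - Y N \<omega>)\<^sup>2) \<partial>M)"
      by (simp add: nn_integral_add nn_integral_cmult emeasure_space_1)
    also have "\<dots> \<le> ennreal \<delta> + ennreal (t\<^sup>2 / \<delta>) * ennreal c"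
      using elim by (intro add_left_mono mult_left_mono) auto
    also have "\<dots> = ennreal (\<delta> + t\<^sup>2 / \<delta> * c)"
      using \<open>\<delta> > 0\<close> \<open>c > 0\<close> by (simp flip: ennreal_mult ennreal_plus)
    finally have "dist (char (distr M borel (Y N)) t) (char (distr M borel X) t) \<le> \<delta> + t\<^sup>2 / \<delta> * c"
      using \<open>\<delta> > 0\<close> \<open>c > 0\<close> by (subst (asm) ennreal_le_iff) auto
    also have "t\<^sup>2 / \<delta> * c = \<delta> * (t\<^sup>2 / (t\<^sup>2 + 1))"
      using \<open>\<delta> > 0\<close> by (simp add: c_def power2_eq_square)
    also have "\<dots> \<le> \<delta> * 1"
      using \<open>\<delta> > 0\<close> by (intro mult_left_mono) (auto simp: divide_le_eq_1 add_nonneg_pos)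
    finally show ?case using \<open>e > 0\<close> by (simp add: \<delta>_def)
  qed
qed

text \<open>The small-ball bound decreases as terms are added to the sum. In the limit, omitting the
  summand 1 under the root leaves (\<rho> / \<alpha>)^d up to the constant factor, where \<alpha>^2
  stands for the full sum, possibly 0 or infinite.\<close>

lemma small_ball_bound_tendsto:
  fixes a :: "nat \<Rightarrow> real"
  assumes a: "\<And>n. a n \<ge> 0" and "\<rho> > 0" "d > 0"
  defines "g \<equiv> \<lambda>N. ennreal (exp (1 / 2) * (1 / sqrt (1 + (\<Sum>n<N. a n) / \<rho>\<^sup>2)) ^ d)"
  shows "g \<longlonglongrightarrow> (INF N. g N)"
    and "(INF N. g N) \<le> ennreal (exp (1 / 2) * \<rho> ^ d) * inverse (ennreal_sqrt (\<Sum>n. ennreal (a n)) ^ d)"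
proof -
  let ?T = "\<lambda>N. \<Sum>n<N. a n"
  have T0: "?T N \<ge> 0" for N by (intro sum_nonneg a)
  have "decseq g"
  proof (rule decseq_SucI)
    fix N
    have "?T N \<le> ?T (Suc N)" using a by simp
    then have "1 / sqrt (1 + ?T (Suc N) / \<rho>\<^sup>2) \<le> 1 / sqrt (1 + ?T N / \<rho>\<^sup>2)"
      using T0[of N] by (intro divide_left_mono real_sqrt_le_mono add_left_mono divide_right_mono)
        (auto intro!: mult_pos_pos add_pos_nonneg divide_nonneg_nonneg sum_nonneg a)
    then show "g (Suc N) \<le> g N"
      unfolding g_def by (intro ennreal_leI mult_left_mono power_mono)
         (auto intro!: divide_nonneg_nonneg add_nonneg_nonneg sum_nonneg a)
  qed
  then show INF: "g \<longlonglongrightarrow> (INF N. g N)" by (rule LIMSEQ_INF)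
  have T: "(\<lambda>N. ennreal (?T N)) \<longlonglongrightarrow> (\<Sum>n. ennreal (a n))"
    using summable_LIMSEQ[OF summableI, of "\<lambda>n. ennreal (a n)"] a by (simp add: sum_ennreal)
  show "(INF N. g N) \<le> ennreal (exp (1 / 2) * \<rho> ^ d) * inverse (ennreal_sqrt (\<Sum>n. ennreal (a n)) ^ d)"
  proof (cases "(\<Sum>n. ennreal (a n))")
    case (real t)
    then have Tt: "?T \<longlonglongrightarrow> t"
      using T T0 by (simp add: tendsto_ennreal_iff)
    have "g \<longlonglongrightarrow> ennreal (exp (1 / 2) * (1 / sqrt (1 + t / \<rho>\<^sup>2)) ^ d)"
      unfolding g_def using Tt real(1) assms(2)
      by (intro tendsto_ennrealI tendsto_intros) (auto simp: add_nonneg_eq_0_iff)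
    with INF have eq: "(INF N. g N) = ennreal (exp (1 / 2) * (1 / sqrt (1 + t / \<rho>\<^sup>2)) ^ d)"
      by (rule LIMSEQ_unique)
    show ?thesis
    proof (cases "t = 0")
      \<comment> \<open>The inverse of 0 is infinite in \<open>ennreal\<close>, so the right-hand
        side is infinite.\<close>
      case True
      then show ?thesis
        using assms(2,3) by (simp add: real(2) ennreal_sqrt_def ennreal_mult_top zero_power)
    next
      case False
      then have "t > 0" using real(1) by simp
      have "sqrt t / \<rho> = sqrt (t / \<rho>\<^sup>2)" using assms(2) by (simp add: real_sqrt_divide)
      also have "\<dots> \<le> sqrt (1 + t / \<rho>\<^sup>2)" by simp
      finally have "1 / sqrt (1 + t / \<rho>\<^sup>2) \<le> \<rho> / sqrt t"
        using \<open>t > 0\<close> assms(2) by (simp add: field_simps add_pos_pos)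
      then have "exp (1 / 2) * (1 / sqrt (1 + t / \<rho>\<^sup>2)) ^ d \<le> exp (1 / 2) * (\<rho> / sqrt t) ^ d"
        using \<open>t > 0\<close> by (intro mult_left_mono power_mono) auto
      also have "\<dots> = exp (1 / 2) * \<rho> ^ d * inverse (sqrt t ^ d)"
        by (simp add: power_divide inverse_eq_divide)
      finally show ?thesis
        unfolding eq real(2) ennreal_sqrt_def using \<open>t > 0\<close> assms(2)
        by (simp add: ennreal_power inverse_ennreal flip: ennreal_mult)
    qed
  next
    \<comment> \<open>Here the right-hand side is 0, and the bounds must really tend to 0; a
      positive exponent \<open>d\<close> makes \<open>0 ^ d\<close> vanish.\<close>
    case top
    then have Tt: "filterlim ?T at_top sequentially"
      using T by (simp add: ennreal_tendsto_top_eq_at_top)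
    have "filterlim (\<lambda>N. 1 + ?T N / \<rho>\<^sup>2) at_top sequentially"
    proof (rule filterlim_tendsto_add_at_top[OF tendsto_const])
      show "filterlim (\<lambda>N. ?T N / \<rho>\<^sup>2) at_top sequentially"
        using filterlim_tendsto_pos_mult_at_top[OF tendsto_const _ Tt, of "inverse (\<rho>\<^sup>2)"] assms(2)
        by (simp add: field_simps)
    qed
    then have "filterlim (\<lambda>N. sqrt (1 + ?T N / \<rho>\<^sup>2)) at_top sequentially"
      by (rule filterlim_compose[OF sqrt_at_top])
    then have "(\<lambda>N. 1 / sqrt (1 + ?T N / \<rho>\<^sup>2)) \<longlonglongrightarrow> 0"
      by (intro tendsto_divide_0[OF tendsto_const] filterlim_at_top_imp_at_infinity)
    then have "(\<lambda>N. exp (1 / 2) * (1 / sqrt (1 + ?T N / \<rho>\<^sup>2)) ^ d) \<longlonglongrightarrow> exp (1 / 2) * 0 ^ d"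
      by (intro tendsto_intros)
    then have "g \<longlonglongrightarrow> ennreal (exp (1 / 2) * 0 ^ d)"
      unfolding g_def by (rule tendsto_ennrealI)
    with INF have "(INF N. g N) = ennreal (exp (1 / 2) * 0 ^ d)"
      by (rule LIMSEQ_unique)
    then show ?thesis using assms(3) by (simp add: zero_power)
  qed
qed

section \<open>Gaussian series\<close>

locale gaussian_series = Q: prob_space Q + P: prob_space P
  for Q :: "'q measure" and P :: "'w measure" +
  fixes E :: "nat \<Rightarrow> 'q \<Rightarrow> real" and S :: "nat \<Rightarrow> real^'d^'d" and \<alpha> \<beta> :: "nat \<Rightarrow> real"
    and \<xi> :: "nat \<Rightarrow> 'w \<Rightarrow> real^'d" and \<Xi> :: "'w \<Rightarrow> ('q \<Rightarrow> real^'d) set"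
  assumes E: "complete_orthonormal_system Q E"
    and S: "\<And>n. sym_pos_def (S n)"
    and S_bounds: "\<And>n v. norm v = 1 \<Longrightarrow> (\<alpha> n)\<^sup>2 \<le> (S n *v v) \<bullet> v \<and> (S n *v v) \<bullet> v \<le> (\<beta> n)\<^sup>2"
    and \<beta>: "summable (\<lambda>n. (\<beta> n)\<^sup>2)"
    and \<xi>: "\<And>n. centered_normal P (\<xi> n) (S n)"
    and indep: "P.indep_vars (\<lambda>_. borel) \<xi> UNIV"
    and \<Xi>: "L2_series_sum P Q E \<xi> \<Xi>"
begin

text \<open>In contrast to the class \<open>\<Xi> \<omega>\<close>, a function of the point
  \<open>q\<close>, jointly measurable in \<open>\<omega>\<close> and \<open>q\<close>; this is what
  makes Fubini's theorem applicable.\<close>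

definition partial_sum :: "nat \<Rightarrow> 'w \<Rightarrow> 'q \<Rightarrow> real^'d" where
  "partial_sum N \<omega> q = (\<Sum>n<N. E n q *\<^sub>R \<xi> n \<omega>)"

text \<open>Measurability of the integrand is not claimed: the quantity enters estimates as the
  integral of \<open>D\<close> in \<open>nn_integral_le_add_nonmeasurable\<close>.\<close>

definition mean_square_error :: "nat \<Rightarrow> ennreal" where
  "mean_square_error N = (\<integral>\<^sup>+ \<omega>. ennreal ((L2_dist Q (\<Xi> \<omega>) (L2_class Q (partial_sum N \<omega>)))\<^sup>2) \<partial>P)"

lemma mean_square_error_tendsto: "mean_square_error \<longlonglongrightarrow> 0"
  using \<Xi> unfolding L2_series_sum_def mean_square_error_def partial_sum_def by simp

lemma \<Xi>_measurable [measurable]: "\<Xi> \<in> measurable P (L2_borel Q)"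
  using \<Xi> by (simp add: L2_series_sum_def)

lemma \<Xi>_L2: "\<omega> \<in> space P \<Longrightarrow> \<Xi> \<omega> \<in> L2 Q"
  using measurable_space[OF \<Xi>_measurable] by (simp add: L2_borel_def)

lemma E_L2: "E n \<in> L2_fun Q"
  using E by (simp add: complete_orthonormal_system_def)

lemma E_measurable [measurable]: "E n \<in> borel_measurable Q"
  by (rule L2_fun_measurable[OF E_L2])

lemma E_integral: "(\<integral>q. (E n q)\<^sup>2 \<partial>Q) = 1"
  using E by (simp add: complete_orthonormal_system_def power2_eq_square)

lemma \<xi>_measurable [measurable]: "\<xi> n \<in> borel_measurable P"
  using \<xi>[of n] by (simp add: centered_normal_def)

lemma partial_sum_measurable [measurable]:
  assumes [measurable]: "f \<in> measurable M P" "g \<in> measurable M Q"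
  shows "(\<lambda>x. partial_sum N (f x) (g x)) \<in> borel_measurable M"
  unfolding partial_sum_def by measurable

lemma partial_sum_L2: "partial_sum N \<omega> \<in> L2_fun Q"
  unfolding partial_sum_def[abs_def] by (intro L2_fun_sum L2_fun_scale_right E_L2)

lemma S_bounds_norm:
  shows S_lower: "(\<alpha> n)\<^sup>2 * (norm v)\<^sup>2 \<le> (S n *v v) \<bullet> v"
    and S_upper: "(S n *v v) \<bullet> v \<le> (\<beta> n)\<^sup>2 * (norm v)\<^sup>2"
proof -
  have "(\<alpha> n)\<^sup>2 * (norm v)\<^sup>2 \<le> (S n *v v) \<bullet> v \<and> (S n *v v) \<bullet> v \<le> (\<beta> n)\<^sup>2 * (norm v)\<^sup>2"
  proof (cases "v = 0")
    case False
    define w where "w = v /\<^sub>R norm v"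
    have v: "v = norm v *\<^sub>R w" and w: "norm w = 1" using False by (auto simp: w_def)
    have "(S n *v v) \<bullet> v = ((S n *v w) \<bullet> w) * (norm v)\<^sup>2"
      by (subst v, subst (2) v) (simp add: matrix_vector_mult_scaleR power2_eq_square mult_ac)
    then show ?thesis
      using S_bounds[OF w, of n] by (auto intro: mult_right_mono)
  qed simp
  then show "(\<alpha> n)\<^sup>2 * (norm v)\<^sup>2 \<le> (S n *v v) \<bullet> v" "(S n *v v) \<bullet> v \<le> (\<beta> n)\<^sup>2 * (norm v)\<^sup>2"
    by auto
qed

subsection \<open>Finite quadratic moment\<close>

text \<open>A crude bound by Cauchy--Schwarz on the finite sum. The factor \<open>real N\<close>
  does no harm, as only one fixed \<open>N\<close> will be used.\<close>

lemma partial_sum_second_moment: "(\<integral>q. (norm (partial_sum N \<omega> q))\<^sup>2 \<partial>Q) \<le> real N * (\<Sum>n<N. (norm (\<xi> n \<omega>))\<^sup>2)"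
proof -
  let ?c = "\<Sum>n<N. (norm (\<xi> n \<omega>))\<^sup>2"
  have int: "integrable Q (\<lambda>q. (E n q)\<^sup>2)" for n
    using E_L2[of n] by (simp add: L2_fun_def)
  have "(\<integral>q. (norm (partial_sum N \<omega> q))\<^sup>2 \<partial>Q) \<le> (\<integral>q. (\<Sum>n<N. (E n q)\<^sup>2) * ?c \<partial>Q)"
  proof (rule integral_mono)
    fix q
    have "norm (partial_sum N \<omega> q) \<le> (\<Sum>n<N. \<bar>E n q\<bar> * norm (\<xi> n \<omega>))"
      unfolding partial_sum_def by (rule order_trans[OF norm_sum]) simp
    then have "(norm (partial_sum N \<omega> q))\<^sup>2 \<le> (\<Sum>n<N. \<bar>E n q\<bar> * norm (\<xi> n \<omega>))\<^sup>2"
      by (intro power_mono) auto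
    also have "\<dots> \<le> (\<Sum>n<N. \<bar>E n q\<bar>\<^sup>2) * ?c"
      by (rule Cauchy_Schwarz_ineq_sum)
    finally show "(norm (partial_sum N \<omega> q))\<^sup>2 \<le> (\<Sum>n<N. (E n q)\<^sup>2) * ?c" by simp
  qed (use partial_sum_L2[of N \<omega>] int in \<open>auto simp: L2_fun_def\<close>)
  also have "\<dots> = real N * ?c"
    using int by (simp add: E_integral)
  finally show ?thesis .
qed

text \<open>The base point is the image of the zero class. One partial sum with mean square error
  below 1 suffices: it has finite second moment, and the remainder is controlled by that
  error.\<close>

lemma second_moment_finite:
  "(\<integral>\<^sup>+\<omega>. ennreal ((W2 (iota Q (\<Xi> \<omega>)) (iota Q (L2_class Q (\<lambda>q. 0))))\<^sup>2) \<partial>P) < \<infinity>"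
proof -
  let ?Z = "L2_class Q (\<lambda>q. 0 :: real^'d)"
  obtain N where N: "mean_square_error N < 1"
    using order_tendstoD(2)[OF mean_square_error_tendsto zero_less_one] by (auto simp: eventually_sequentially)
  let ?G = "\<lambda>\<omega>. ennreal (2 * real N) * (\<Sum>n<N. ennreal ((norm (\<xi> n \<omega>))\<^sup>2))"
  have Z: "?Z \<in> L2 Q" by (rule L2_class_in_L2[OF L2_fun_0])
  have "(\<integral>\<^sup>+\<omega>. ennreal ((W2 (iota Q (\<Xi> \<omega>)) (iota Q ?Z))\<^sup>2) \<partial>P)
      \<le> (\<integral>\<^sup>+\<omega>. ?G \<omega> \<partial>P) + ennreal 2 * mean_square_error N"
    unfolding mean_square_error_def
  proof (rule nn_integral_le_add_nonmeasurable)
    show "?G \<in> borel_measurable P" by measurable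
    show "?G \<omega> < \<infinity>" for \<omega>
      by (simp add: ennreal_mult_less_top less_top)
    fix \<omega> assume "\<omega> \<in> space P"
    then have X: "\<Xi> \<omega> \<in> L2 Q" by (rule \<Xi>_L2)
    let ?Y = "L2_class Q (partial_sum N \<omega>)"
    have "0 \<le> W2 (iota Q (\<Xi> \<omega>)) (iota Q ?Z)" by (simp add: W2_def)
    then have "(W2 (iota Q (\<Xi> \<omega>)) (iota Q ?Z))\<^sup>2 \<le> (L2_dist Q (\<Xi> \<omega>) ?Z)\<^sup>2"
      by (intro power_mono W2_iota_le X Z)
    also have "\<dots> \<le> 2 * (L2_dist Q (\<Xi> \<omega>) ?Y)\<^sup>2 + 2 * (L2_dist Q ?Y ?Z)\<^sup>2"
      by (rule L2_dist_square_triangle[OF X L2_class_in_L2[OF partial_sum_L2] Z])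
    also have "(L2_dist Q ?Y ?Z)\<^sup>2 = (\<integral>q. (norm (partial_sum N \<omega> q))\<^sup>2 \<partial>Q)"
      by (simp add: L2_dist_class partial_sum_L2 L2_fun_0 integral_nonneg_AE)
    also have "\<dots> \<le> real N * (\<Sum>n<N. (norm (\<xi> n \<omega>))\<^sup>2)"
      by (rule partial_sum_second_moment)
    finally have "(W2 (iota Q (\<Xi> \<omega>)) (iota Q ?Z))\<^sup>2
        \<le> 2 * real N * (\<Sum>n<N. (norm (\<xi> n \<omega>))\<^sup>2) + 2 * (L2_dist Q (\<Xi> \<omega>) ?Y)\<^sup>2"
      by simp
    then have "ennreal ((W2 (iota Q (\<Xi> \<omega>)) (iota Q ?Z))\<^sup>2)
        \<le> ennreal (2 * real N * (\<Sum>n<N. (norm (\<xi> n \<omega>))\<^sup>2) + 2 * (L2_dist Q (\<Xi> \<omega>) ?Y)\<^sup>2)"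
      by (rule ennreal_leI)
    also have "\<dots> = ?G \<omega> + ennreal 2 * ennreal ((L2_dist Q (\<Xi> \<omega>) ?Y)\<^sup>2)"
      by (subst ennreal_plus) (auto intro!: sum_nonneg simp: ennreal_mult sum_nonneg simp flip: sum_ennreal)
    finally show "ennreal ((W2 (iota Q (\<Xi> \<omega>)) (iota Q ?Z))\<^sup>2)
        \<le> ?G \<omega> + ennreal 2 * ennreal ((L2_dist Q (\<Xi> \<omega>) ?Y)\<^sup>2)" .
  qed simp
  also have "(\<integral>\<^sup>+\<omega>. ?G \<omega> \<partial>P) = ennreal (2 * real N) * (\<Sum>n<N. \<integral>\<^sup>+\<omega>. ennreal ((norm (\<xi> n \<omega>))\<^sup>2) \<partial>P)"
    by (subst nn_integral_cmult) (auto simp: nn_integral_sum simp del: sum_ennreal)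
  also have "\<dots> + ennreal 2 * mean_square_error N < \<infinity>"
  proof -
    have "(\<Sum>n<N. \<integral>\<^sup>+\<omega>. ennreal ((norm (\<xi> n \<omega>))\<^sup>2) \<partial>P) < \<top>"
      using P.centered_normal_second_moment[OF S \<xi>] by (simp add: less_top)
    moreover have "mean_square_error N < \<top>" using N by (auto intro: less_trans)
    ultimately show ?thesis by (simp add: ennreal_mult_less_top)
  qed
  finally show ?thesis .
qed

subsection \<open>Close pairs in the mean\<close>

lemma close_pairs_iota_partial_sum:
  "close_pairs a (iota Q (L2_class Q (partial_sum N \<omega>)))
    = (\<integral>\<^sup>+q1. \<integral>\<^sup>+q2. indicator {..<a} (dist (partial_sum N \<omega> q1) (partial_sum N \<omega> q2)) \<partial>Q \<partial>Q)"
proof -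
  interpret D: prob_space "distr Q borel (partial_sum N \<omega>)"
    by (rule Q.prob_space_distr) (rule L2_fun_measurable[OF partial_sum_L2])
  have [measurable]: "partial_sum N \<omega> \<in> borel_measurable Q" by (rule L2_fun_measurable[OF partial_sum_L2])
  show ?thesis
    unfolding close_pairs_def iota_class[OF partial_sum_L2]
    by (simp add: nn_integral_distr)
qed

lemma close_pairs_mean_le:
  assumes "r > 0"
  shows "(\<integral>\<^sup>+\<omega>. close_pairs a (iota Q (\<Xi> \<omega>)) \<partial>P)
    \<le> (\<integral>\<^sup>+\<omega>. \<integral>\<^sup>+q1. \<integral>\<^sup>+q2. indicator {..<a + 2 * r} (dist (partial_sum N \<omega> q1) (partial_sum N \<omega> q2)) \<partial>Q \<partial>Q \<partial>P)
      + ennreal (2 / r\<^sup>2) * mean_square_error N"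
  unfolding mean_square_error_def
proof (rule nn_integral_le_add_nonmeasurable)
  let ?G = "\<lambda>\<omega>. \<integral>\<^sup>+q1. \<integral>\<^sup>+q2. indicator {..<a + 2 * r} (dist (partial_sum N \<omega> q1) (partial_sum N \<omega> q2)) \<partial>Q \<partial>Q"
  show "?G \<in> borel_measurable P" by measurable
  show "?G \<omega> < \<infinity>" for \<omega>
  proof -
    have "?G \<omega> \<le> (\<integral>\<^sup>+q1. \<integral>\<^sup>+q2. 1 \<partial>Q \<partial>Q)"
      by (intro nn_integral_mono) (auto simp: indicator_def)
    then show ?thesis by (simp add: Q.emeasure_space_1 le_less_trans)
  qed
  fix \<omega> assume "\<omega> \<in> space P"
  then have X: "\<Xi> \<omega> \<in> L2 Q" by (rule \<Xi>_L2)
  obtain \<gamma> where \<gamma>: "\<gamma> \<in> couplings (iota Q (\<Xi> \<omega>)) (iota Q (L2_class Q (partial_sum N \<omega>)))"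
    "(\<integral>\<^sup>+ z. ennreal ((dist (fst z) (snd z))\<^sup>2) \<partial>\<gamma>) = ennreal ((L2_dist Q (\<Xi> \<omega>) (L2_class Q (partial_sum N \<omega>)))\<^sup>2)"
    using iota_coupling[OF X L2_class_in_L2[OF partial_sum_L2]] .
  show "close_pairs a (iota Q (\<Xi> \<omega>))
      \<le> ?G \<omega> + ennreal (2 / r\<^sup>2) * ennreal ((L2_dist Q (\<Xi> \<omega>) (L2_class Q (partial_sum N \<omega>)))\<^sup>2)"
    using close_pairs_coupling[OF P2_prob[OF iota_in_P2[OF Q.prob_space_axioms X]] \<gamma>(1) assms, of a]
    by (simp add: \<gamma>(2) close_pairs_iota_partial_sum)
qed (use assms in simp)

text \<open>The bound of \<open>small_ball_estimate\<close> for the difference of the partial sums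
  at \<open>q1\<close> and \<open>q2\<close>, with \<open>a\<close> the \<open>N\<close>-th partial
  sum of \<open>series_alpha_sq\<close>.\<close>

definition ball_bound :: "nat \<Rightarrow> real \<Rightarrow> 'q \<Rightarrow> 'q \<Rightarrow> ennreal" where
  "ball_bound N \<rho> q1 q2 = ennreal (exp (1 / 2)
    * (1 / sqrt (1 + (\<Sum>n<N. (\<alpha> n)\<^sup>2 * (E n q1 - E n q2)\<^sup>2) / \<rho>\<^sup>2)) ^ CARD('d))"

text \<open>Tested against u, the difference is a sum of independent normal variables
  \<open>\<xi> n \<omega> \<bullet> (?c n *\<^sub>R u)\<close>. The lower bounds on the matrices
  make its variance at least |u|^2 times the truncated series for \<alpha>^2.\<close>

lemma partial_sum_small_ball:
  assumes "\<rho> > 0" "q1 \<in> space Q" "q2 \<in> space Q"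
  shows "(\<integral>\<^sup>+\<omega>. indicator {..<\<rho>} (dist (partial_sum N \<omega> q1) (partial_sum N \<omega> q2)) \<partial>P) \<le> ball_bound N \<rho> q1 q2"
proof -
  let ?c = "\<lambda>n. E n q1 - E n q2"
  have [measurable]: "(\<lambda>\<omega>. partial_sum N \<omega> q1 - partial_sum N \<omega> q2) \<in> borel_measurable P"
    unfolding partial_sum_def by measurable
  have inner: "(partial_sum N \<omega> q1 - partial_sum N \<omega> q2) \<bullet> u = (\<Sum>n<N. \<xi> n \<omega> \<bullet> (?c n *\<^sub>R u))" for \<omega> u
    unfolding partial_sum_def sum_subtractf[symmetric] inner_sum_left
    by (simp add: inner_diff_left algebra_simps)
  have "(\<integral>\<^sup>+\<omega>. indicator {..<\<rho>} (norm (partial_sum N \<omega> q1 - partial_sum N \<omega> q2)) \<partial>P) \<le> ball_bound N \<rho> q1 q2"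
    unfolding ball_bound_def
  proof (rule P.small_ball_estimate)
    show "char (distr P borel (\<lambda>\<omega>. (partial_sum N \<omega> q1 - partial_sum N \<omega> q2) \<bullet> u)) 1
        = of_real (exp (- ((\<Sum>n<N. (S n *v (?c n *\<^sub>R u)) \<bullet> (?c n *\<^sub>R u)) / 2)))" for u
      unfolding inner using P.char_sum_centered_normal[OF S \<xi> indep, where N=N and u="\<lambda>n. ?c n *\<^sub>R u" and t=1] by simp
    show "(\<Sum>n<N. (\<alpha> n)\<^sup>2 * (?c n)\<^sup>2) * (norm u)\<^sup>2 \<le> (\<Sum>n<N. (S n *v (?c n *\<^sub>R u)) \<bullet> (?c n *\<^sub>R u))" for u
      unfolding sum_distrib_right
    proof (rule sum_mono)
      fix n
      show "(\<alpha> n)\<^sup>2 * (?c n)\<^sup>2 * (norm u)\<^sup>2 \<le> (S n *v (?c n *\<^sub>R u)) \<bullet> (?c n *\<^sub>R u)"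
        using S_lower[of n "?c n *\<^sub>R u"] by (simp add: power_mult_distrib mult.assoc)
    qed
  qed (use assms in \<open>auto intro: sum_nonneg\<close>)
  then show ?thesis by (simp add: dist_norm)
qed

lemma ball_bound_measurable [measurable]:
  assumes [measurable]: "f \<in> measurable M Q" "h \<in> measurable M Q"
  shows "(\<lambda>x. ball_bound N \<rho> (f x) (h x)) \<in> borel_measurable M"
  unfolding ball_bound_def by measurable

lemma partial_sum_close_pairs_mean:
  assumes "\<rho> > 0"
  shows "(\<integral>\<^sup>+\<omega>. \<integral>\<^sup>+q1. \<integral>\<^sup>+q2. indicator {..<\<rho>} (dist (partial_sum N \<omega> q1) (partial_sum N \<omega> q2)) \<partial>Q \<partial>Q \<partial>P)
    \<le> (\<integral>\<^sup>+z. ball_bound N \<rho> (fst z) (snd z) \<partial>(Q \<Otimes>\<^sub>M Q))"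
proof -
  interpret QP: pair_sigma_finite Q P ..
  have "(\<integral>\<^sup>+\<omega>. \<integral>\<^sup>+q1. \<integral>\<^sup>+q2. indicator {..<\<rho>} (dist (partial_sum N \<omega> q1) (partial_sum N \<omega> q2)) \<partial>Q \<partial>Q \<partial>P)
      = (\<integral>\<^sup>+q1. \<integral>\<^sup>+\<omega>. \<integral>\<^sup>+q2. indicator {..<\<rho>} (dist (partial_sum N \<omega> q1) (partial_sum N \<omega> q2)) \<partial>Q \<partial>P \<partial>Q)"
    by (rule QP.Fubini') measurable
  also have "\<dots> = (\<integral>\<^sup>+q1. \<integral>\<^sup>+q2. \<integral>\<^sup>+\<omega>. indicator {..<\<rho>} (dist (partial_sum N \<omega> q1) (partial_sum N \<omega> q2)) \<partial>P \<partial>Q \<partial>Q)"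
    by (intro nn_integral_cong QP.Fubini') measurable
  also have "\<dots> \<le> (\<integral>\<^sup>+q1. \<integral>\<^sup>+q2. ball_bound N \<rho> q1 q2 \<partial>Q \<partial>Q)"
    by (intro nn_integral_mono partial_sum_small_ball assms)
  also have "\<dots> = (\<integral>\<^sup>+z. ball_bound N \<rho> (fst z) (snd z) \<partial>(Q \<Otimes>\<^sub>M Q))"
    using Q.nn_integral_fst[of "\<lambda>z. ball_bound N \<rho> (fst z) (snd z)" Q] by simp
  finally show ?thesis .
qed

definition alpha_integral :: ennreal where
  "alpha_integral = (\<integral>\<^sup>+ z. inverse (ennreal_sqrt (series_alpha_sq \<alpha> E (fst z) (snd z)) ^ CARD('d)) \<partial>(Q \<Otimes>\<^sub>M Q))"

text \<open>The radius is fixed while \<open>N\<close> tends to infinity, so the error term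
  disappears. The bounds for the partial sums pass to the limit by dominated convergence, with a
  constant majorant on the probability space of pairs.\<close>

lemma close_pairs_mean_bound:
  assumes "r > 0"
  shows "(\<integral>\<^sup>+\<omega>. close_pairs (2 * r) (iota Q (\<Xi> \<omega>)) \<partial>P) \<le> ennreal (exp (1 / 2) * (3 * r) ^ CARD('d)) * alpha_integral"
proof -
  interpret QQ: pair_prob_space Q Q ..
  let ?g = "\<lambda>N z. ball_bound N (3 * r) (fst z) (snd z)"
  have lim: "(\<lambda>N. ?g N z) \<longlonglongrightarrow> (INF N. ?g N z)" for z
    unfolding ball_bound_def using assms by (intro small_ball_bound_tendsto(1)) auto
  have inf: "(INF N. ?g N z) \<le> ennreal (exp (1 / 2) * (3 * r) ^ CARD('d))
      * inverse (ennreal_sqrt (series_alpha_sq \<alpha> E (fst z) (snd z)) ^ CARD('d))" for z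
    unfolding ball_bound_def series_alpha_sq_def using assms by (intro small_ball_bound_tendsto(2)) auto
  have "(\<lambda>N. \<integral>\<^sup>+z. ?g N z \<partial>(Q \<Otimes>\<^sub>M Q)) \<longlonglongrightarrow> (\<integral>\<^sup>+z. (INF N. ?g N z) \<partial>(Q \<Otimes>\<^sub>M Q))"
  proof (rule nn_integral_dominated_convergence)
    show "AE z in Q \<Otimes>\<^sub>M Q. ?g N z \<le> ennreal (exp (1 / 2))" for N
    proof (rule AE_I2)
      fix z
      let ?t = "(\<Sum>n<N. (\<alpha> n)\<^sup>2 * (E n (fst z) - E n (snd z))\<^sup>2) / (3 * r)\<^sup>2"
      have "?t \<ge> 0" by (auto intro!: divide_nonneg_nonneg sum_nonneg)
      then have "1 / sqrt (1 + ?t) \<le> 1" by (simp add: divide_le_eq_1)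
      then have "(1 / sqrt (1 + ?t)) ^ CARD('d) \<le> 1"
        using \<open>?t \<ge> 0\<close> by (intro power_le_one) auto
      then show "?g N z \<le> ennreal (exp (1 / 2))"
        unfolding ball_bound_def by (intro ennreal_leI mult_left_le) auto
    qed
    show "(\<integral>\<^sup>+z. ennreal (exp (1 / 2)) \<partial>(Q \<Otimes>\<^sub>M Q)) < \<infinity>"
      by (simp add: QQ.emeasure_space_1)
  qed (use lim in auto)
  \<comment> \<open>The displacement allowed to each point is \<open>r / 2\<close>, which enlarges
    the radius from \<open>2 * r\<close> to \<open>3 * r\<close>.\<close>
  moreover have "(\<lambda>N. ennreal (2 / (r / 2)\<^sup>2) * mean_square_error N) \<longlonglongrightarrow> ennreal (2 / (r / 2)\<^sup>2) * 0"
    by (intro ennreal_tendsto_cmult mean_square_error_tendsto) simp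
  ultimately have "(\<lambda>N. (\<integral>\<^sup>+z. ?g N z \<partial>(Q \<Otimes>\<^sub>M Q)) + ennreal (2 / (r / 2)\<^sup>2) * mean_square_error N)
      \<longlonglongrightarrow> (\<integral>\<^sup>+z. (INF N. ?g N z) \<partial>(Q \<Otimes>\<^sub>M Q)) + ennreal (2 / (r / 2)\<^sup>2) * 0"
    by (rule tendsto_add)
  then have "(\<integral>\<^sup>+\<omega>. close_pairs (2 * r) (iota Q (\<Xi> \<omega>)) \<partial>P)
      \<le> (\<integral>\<^sup>+z. (INF N. ?g N z) \<partial>(Q \<Otimes>\<^sub>M Q)) + ennreal (2 / (r / 2)\<^sup>2) * 0"
  proof (rule LIMSEQ_le_const, intro exI allI impI)
    fix N
    have "(\<integral>\<^sup>+\<omega>. close_pairs (2 * r) (iota Q (\<Xi> \<omega>)) \<partial>P)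
      \<le> (\<integral>\<^sup>+\<omega>. \<integral>\<^sup>+q1. \<integral>\<^sup>+q2. indicator {..<3 * r} (dist (partial_sum N \<omega> q1) (partial_sum N \<omega> q2)) \<partial>Q \<partial>Q \<partial>P)
        + ennreal (2 / (r / 2)\<^sup>2) * mean_square_error N"
      using close_pairs_mean_le[of "r / 2" "2 * r" N] assms by simp
    also have "\<dots> \<le> (\<integral>\<^sup>+z. ?g N z \<partial>(Q \<Otimes>\<^sub>M Q)) + ennreal (2 / (r / 2)\<^sup>2) * mean_square_error N"
      using partial_sum_close_pairs_mean[of "3 * r" N] assms by (intro add_right_mono) auto
    finally show "(\<integral>\<^sup>+\<omega>. close_pairs (2 * r) (iota Q (\<Xi> \<omega>)) \<partial>P)
        \<le> (\<integral>\<^sup>+z. ?g N z \<partial>(Q \<Otimes>\<^sub>M Q)) + ennreal (2 / (r / 2)\<^sup>2) * mean_square_error N" .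
  qed
  also have "\<dots> \<le> (\<integral>\<^sup>+z. ennreal (exp (1 / 2) * (3 * r) ^ CARD('d))
      * inverse (ennreal_sqrt (series_alpha_sq \<alpha> E (fst z) (snd z)) ^ CARD('d)) \<partial>(Q \<Otimes>\<^sub>M Q))"
    using inf by (simp add: nn_integral_mono)
  also have "\<dots> = ennreal (exp (1 / 2) * (3 * r) ^ CARD('d)) * alpha_integral"
    unfolding alpha_integral_def series_alpha_sq_def ennreal_sqrt_def by (rule nn_integral_cmult) measurable
  finally show ?thesis .
qed

subsection \<open>The law and its image\<close>

abbreviation law :: "('q \<Rightarrow> real^'d) set measure" where
  "law \<equiv> distr P (L2_borel Q) \<Xi>"

abbreviation G :: "(real^'d) measure measure" where
  "G \<equiv> distr law P2_borel (iota Q)"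

lemma prob_space_law: "prob_space law"
  by (rule P.prob_space_distr) measurable

lemma iota_law_measurable: "iota Q \<in> measurable law P2_borel"
  using iota_measurable[OF Q.prob_space_axioms] by simp

lemma nn_integral_G:
  "f \<in> borel_measurable P2_borel \<Longrightarrow> (\<integral>\<^sup>+\<mu>. f \<mu> \<partial>G) = (\<integral>\<^sup>+\<omega>. f (iota Q (\<Xi> \<omega>)) \<partial>P)"
proof -
  assume [measurable]: "f \<in> borel_measurable P2_borel"
  note iota_measurable[OF Q.prob_space_axioms, measurable]
  show "(\<integral>\<^sup>+\<mu>. f \<mu> \<partial>G) = (\<integral>\<^sup>+\<omega>. f (iota Q (\<Xi> \<omega>)) \<partial>P)"
    by (simp add: nn_integral_distr)
qed

lemma G_in_P2P2: "G \<in> P2P2"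
proof -
  let ?\<nu> = "iota Q (L2_class Q (\<lambda>q. 0 :: real^'d))"
  have "?\<nu> \<in> P2"
    by (intro iota_in_P2 Q.prob_space_axioms L2_class_in_L2 L2_fun_0)
  moreover have "(\<integral>\<^sup>+ \<mu>. ennreal ((W2 \<mu> ?\<nu>)\<^sup>2) \<partial>G) < \<infinity>"
  proof -
    \<comment> \<open>Two successive image measures give two inequalities, valid without
      measurability of the distance to the base point.\<close>
    have "(\<integral>\<^sup>+ \<mu>. ennreal ((W2 \<mu> ?\<nu>)\<^sup>2) \<partial>G) \<le> (\<integral>\<^sup>+ X. ennreal ((W2 (iota Q X) ?\<nu>)\<^sup>2) \<partial>law)"
      by (rule nn_integral_distr_le[OF iota_law_measurable])
    also have "\<dots> \<le> (\<integral>\<^sup>+\<omega>. ennreal ((W2 (iota Q (\<Xi> \<omega>)) ?\<nu>)\<^sup>2) \<partial>P)"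
      by (rule nn_integral_distr_le) measurable
    also note second_moment_finite
    finally show ?thesis .
  qed
  moreover have "prob_space G"
    by (rule prob_space.prob_space_distr[OF prob_space_law iota_law_measurable])
  ultimately show ?thesis by (auto simp: P2P2_def)
qed

text \<open>Fatou's lemma applies because \<open>close_pairs\<close> is measurable on the
  Wasserstein space. The resulting almost sure event is chosen before the hypersurface, so it serves
  all hypersurfaces simultaneously.\<close>

lemma AE_G_P2r:
  assumes fin: "alpha_integral < \<infinity>"
  shows "AE \<mu> in G. \<mu> \<in> P2r"
proof -
  define r where "r k = 1 / real (Suc k)" for k
  have r: "r k > 0" for k by (simp add: r_def)
  have r0: "r \<longlonglongrightarrow> 0"
    unfolding r_def by (rule LIMSEQ_Suc[OF lim_1_over_n])
  let ?f = "\<lambda>k \<mu>. close_pairs (2 * r k) \<mu> / ennreal (r k ^ CARD('d))"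
  note close_pairs_measurable[measurable]
  have f_le: "(\<integral>\<^sup>+\<mu>. ?f k \<mu> \<partial>G) \<le> ennreal (exp (1 / 2) * 3 ^ CARD('d)) * alpha_integral" for k
  proof -
    have rk: "ennreal (r k ^ CARD('d)) \<noteq> 0" "ennreal (r k ^ CARD('d)) \<noteq> \<top>"
      using r[of k] by (auto simp: ennreal_eq_0_iff not_le)
    have "(\<integral>\<^sup>+\<mu>. ?f k \<mu> \<partial>G) = (\<integral>\<^sup>+\<mu>. close_pairs (2 * r k) \<mu> \<partial>G) / ennreal (r k ^ CARD('d))"
      by (rule nn_integral_divide) simp
    also have "\<dots> = (\<integral>\<^sup>+\<omega>. close_pairs (2 * r k) (iota Q (\<Xi> \<omega>)) \<partial>P) / ennreal (r k ^ CARD('d))"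
      by (subst nn_integral_G) auto
    also have "\<dots> \<le> ennreal (exp (1 / 2) * (3 * r k) ^ CARD('d)) * alpha_integral / ennreal (r k ^ CARD('d))"
      by (intro divide_right_mono_ennreal close_pairs_mean_bound r)
    \<comment> \<open>The power of the radius cancels exactly, leaving a bound independent of
      \<open>k\<close>; the \<open>3\<close> stems from the enlarged radius
      \<open>3 * r k\<close>.\<close>
    also have "ennreal (exp (1 / 2) * (3 * r k) ^ CARD('d)) * alpha_integral
        = ennreal (exp (1 / 2) * 3 ^ CARD('d)) * alpha_integral * ennreal (r k ^ CARD('d))"
      using r[of k] by (simp add: ennreal_mult power_mult_distrib mult_ac)
    also have "\<dots> / ennreal (r k ^ CARD('d)) = ennreal (exp (1 / 2) * 3 ^ CARD('d)) * alpha_integral"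
      by (rule ennreal_mult_divide_eq[OF rk])
    finally show ?thesis .
  qed
  have "(\<integral>\<^sup>+\<mu>. liminf (\<lambda>k. ?f k \<mu>) \<partial>G) \<le> liminf (\<lambda>k. \<integral>\<^sup>+\<mu>. ?f k \<mu> \<partial>G)"
    by (rule nn_integral_liminf) simp
  also have "\<dots> \<le> limsup (\<lambda>k. \<integral>\<^sup>+\<mu>. ?f k \<mu> \<partial>G)"
    by (rule Liminf_le_Limsup) simp
  also have "\<dots> \<le> ennreal (exp (1 / 2) * 3 ^ CARD('d)) * alpha_integral"
    by (rule Limsup_bounded) (use f_le in auto)
  also have "\<dots> < \<infinity>"
    using fin by (simp add: ennreal_mult_less_top)
  finally have "AE \<mu> in G. liminf (\<lambda>k. ?f k \<mu>) \<noteq> \<infinity>"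
    by (intro nn_integral_PInf_AE) auto
  moreover have "AE \<mu> in G. \<mu> \<in> P2"
    using AE_space[of G] by (simp add: P2_borel_def)
  ultimately show ?thesis
  proof eventually_elim
    case (elim \<mu>)
    show "\<mu> \<in> P2r"
      unfolding P2r_def
    proof (intro CollectI conjI allI impI)
      show "\<mu> \<in> P2" using elim by simp
      fix A :: "(real^'d) set" assume "dc_hypersurface A"
      then have "A \<in> null_sets lborel" by (rule dc_hypersurface_null)
      then show "A \<in> null_sets \<mu>"
        by (rule null_set_of_liminf_close_pairs[OF P2_prob P2_sets r r0, rotated -1])
           (use elim in \<open>auto simp: less_top\<close>)
    qed
  qed
qed

section \<open>Nondegeneracy of the law of the series\<close>

lemma functional_partial_sum:
  assumes l: "L2_functional Q l"
  shows "l (L2_class Q (partial_sum N \<omega>)) = (\<Sum>n<N. \<xi> n \<omega> \<bullet> (\<chi> i. l (L2_class Q (\<lambda>q. E n q *\<^sub>R axis i 1))))"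
proof -
  have En: "(\<lambda>q. E n q *\<^sub>R x) \<in> L2_fun Q" for n and x :: "real^'d"
    by (rule L2_fun_scale_right[OF E_L2])
  have "l (L2_class Q (\<lambda>q. E n q *\<^sub>R \<xi> n \<omega>)) = \<xi> n \<omega> \<bullet> (\<chi> i. l (L2_class Q (\<lambda>q. E n q *\<^sub>R axis i 1)))" for n
  proof -
    have "E n q *\<^sub>R \<xi> n \<omega> = (\<Sum>i\<in>UNIV. \<xi> n \<omega> $ i *\<^sub>R (E n q *\<^sub>R axis i 1))" for q
      by (subst (1) basis_expansion[symmetric])
         (simp add: scaleR_sum_right scalar_mult_eq_scaleR mult.commute)
    then have "l (L2_class Q (\<lambda>q. E n q *\<^sub>R \<xi> n \<omega>))
        = l (L2_class Q (\<lambda>q. \<Sum>i\<in>UNIV. \<xi> n \<omega> $ i *\<^sub>R (E n q *\<^sub>R axis i 1)))"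
      by simp
    also have "\<dots> = (\<Sum>i\<in>UNIV. l (L2_class Q (\<lambda>q. \<xi> n \<omega> $ i *\<^sub>R (E n q *\<^sub>R axis i 1))))"
      by (rule L2_functional_class_sum[OF l]) (rule L2_fun_scale[OF En])
    also have "\<dots> = (\<Sum>i\<in>UNIV. \<xi> n \<omega> $ i * l (L2_class Q (\<lambda>q. E n q *\<^sub>R axis i 1)))"
      by (intro sum.cong refl L2_functional_class_scale[OF l En])
    finally show ?thesis by (simp add: inner_vec_def)
  qed
  moreover have "partial_sum N \<omega> = (\<lambda>q. \<Sum>n<N. E n q *\<^sub>R \<xi> n \<omega>)"
    by (rule ext) (rule partial_sum_def)
  ultimately show ?thesis
    using L2_functional_class_sum[OF l, of "{..<N}" "\<lambda>n q. E n q *\<^sub>R \<xi> n \<omega>"] En by simp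
qed

text \<open>A functional has variance equal to the sum of the
  \<open>(S n *v v n) \<bullet> v n\<close>, with \<open>v n\<close> its coefficient vectors. The
  sum is finite because the \<open>v n\<close> are bounded and the \<beta>^2 summable, and positive
  because one \<open>v n\<close> is nonzero. Limits of characteristic functions then identify the
  law.\<close>

lemma nondegenerate_law: "nondegenerate_gaussian Q law"
  unfolding nondegenerate_gaussian_def
proof (intro conjI allI impI)
  show "prob_space law" by (rule prob_space_law)
  fix l :: "('q \<Rightarrow> real^'d) set \<Rightarrow> real"
  assume *: "L2_functional Q l \<and> (\<exists>X\<in>L2 Q. l X \<noteq> 0)"
  then have l: "L2_functional Q l" by simp
  define v where "v n = (\<chi> i. l (L2_class Q (\<lambda>q. E n q *\<^sub>R axis i 1)))" for n
  have l_meas [measurable]: "l \<in> borel_measurable (L2_borel Q)"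
    by (rule L2_functional_measurable[OF l])
  obtain C where C: "C \<ge> 0" "\<And>X Y. X \<in> L2 Q \<Longrightarrow> Y \<in> L2 Q \<Longrightarrow> \<bar>l X - l Y\<bar> \<le> C * L2_dist Q X Y"
    "\<And>X. X \<in> L2 Q \<Longrightarrow> \<bar>l X\<bar> \<le> C * L2_norm Q X"
    using L2_functional_Lipschitz[OF l] by metis
  \<comment> \<open>\<open>E n\<close> times a coordinate vector has norm 1, so every coordinate of
    \<open>v n\<close> is at most \<open>C\<close> in absolute value.\<close>
  have v_bound: "(norm (v n))\<^sup>2 \<le> CARD('d) * C\<^sup>2" for n
  proof -
    have "(v n $ i)\<^sup>2 \<le> C\<^sup>2" for i
    proof -
      have "\<bar>v n $ i\<bar> \<le> C * L2_norm Q (L2_class Q (\<lambda>q. E n q *\<^sub>R axis i 1 :: real^'d))"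
        unfolding v_def using C(3)[OF L2_class_in_L2[OF L2_fun_scale_right[OF E_L2]]] by simp
      also have "\<dots> = C"
        by (simp add: L2_norm_class L2_fun_scale_right E_L2 E_integral)
      finally show ?thesis using C(1) by (simp add: abs_le_square_iff[symmetric])
    qed
    then have "(\<Sum>i\<in>UNIV. (v n $ i)\<^sup>2) \<le> (\<Sum>i\<in>(UNIV :: 'd set). C\<^sup>2)"
      by (intro sum_mono) auto
    then show ?thesis by (simp add: norm_vec_def L2_set_def sum_nonneg)
  qed
  let ?a = "\<lambda>n. (S n *v v n) \<bullet> v n"
  have a0: "?a n \<ge> 0" for n
    using S[of n] by (cases "v n = 0") (auto simp: sym_pos_def_def less_imp_le)
  have "summable ?a"
  proof (rule summable_comparison_test')
    show "summable (\<lambda>n. (\<beta> n)\<^sup>2 * (CARD('d) * C\<^sup>2))"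
      using \<beta> by (rule summable_mult2)
    fix n
    have "?a n \<le> (\<beta> n)\<^sup>2 * (norm (v n))\<^sup>2" by (rule S_upper)
    also have "\<dots> \<le> (\<beta> n)\<^sup>2 * (CARD('d) * C\<^sup>2)"
      by (intro mult_left_mono v_bound) auto
    finally show "norm (?a n) \<le> (\<beta> n)\<^sup>2 * (CARD('d) * C\<^sup>2)"
      using a0[of n] by simp
  qed
  define \<sigma> where "\<sigma> = sqrt (\<Sum>n. ?a n)"
  have "\<exists>n. v n \<noteq> 0"
  proof (rule ccontr)
    assume "\<not> (\<exists>n. v n \<noteq> 0)"
    then have "l (L2_class Q (\<lambda>q. E n q *\<^sub>R axis i 1)) = 0" for n i
      by (auto simp: v_def vec_eq_iff)
    then have "l X = 0" if "X \<in> L2 Q" for X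
      by (rule L2_functional_eq_0I[OF l E _ that])
    with * show False by blast
  qed
  then obtain n where "v n \<noteq> 0" by blast
  then have "?a n > 0" using S[of n] by (auto simp: sym_pos_def_def)
  with \<open>summable ?a\<close> a0 have "(\<Sum>n. ?a n) > 0" by (intro suminf_pos2) auto
  then have \<sigma>: "\<sigma> > 0" "\<sigma>\<^sup>2 = (\<Sum>n. ?a n)" by (auto simp: \<sigma>_def)
  let ?Y = "\<lambda>N \<omega>. \<Sum>n<N. \<xi> n \<omega> \<bullet> v n"
  have "(\<lambda>N. \<integral>\<^sup>+\<omega>. ennreal ((l (\<Xi> \<omega>) - ?Y N \<omega>)\<^sup>2) \<partial>P) \<longlonglongrightarrow> 0"
  proof (rule tendsto_sandwich[OF _ _ tendsto_const])
    \<comment> \<open>\<open>C + 1\<close> replaces \<open>C\<close> because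
      \<open>nn_integral_le_add_nonmeasurable\<close> asks for a strictly positive factor.\<close>
    have "(\<lambda>N. ennreal ((C + 1)\<^sup>2) * mean_square_error N) \<longlonglongrightarrow> ennreal ((C + 1)\<^sup>2) * 0"
      by (intro ennreal_tendsto_cmult mean_square_error_tendsto) simp
    then show "(\<lambda>N. ennreal ((C + 1)\<^sup>2) * mean_square_error N) \<longlonglongrightarrow> 0" by simp
    have "(\<integral>\<^sup>+\<omega>. ennreal ((l (\<Xi> \<omega>) - ?Y N \<omega>)\<^sup>2) \<partial>P)
        \<le> (\<integral>\<^sup>+\<omega>. 0 \<partial>P) + ennreal ((C + 1)\<^sup>2) * mean_square_error N" for N
      unfolding mean_square_error_def
    proof (rule nn_integral_le_add_nonmeasurable)
      fix \<omega> assume "\<omega> \<in> space P"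
      then have X: "\<Xi> \<omega> \<in> L2 Q" by (rule \<Xi>_L2)
      let ?d = "L2_dist Q (\<Xi> \<omega>) (L2_class Q (partial_sum N \<omega>))"
      have d: "?d \<ge> 0" by (simp add: L2_dist_def integral_nonneg_AE)
      have "\<bar>l (\<Xi> \<omega>) - ?Y N \<omega>\<bar> \<le> C * ?d"
        using C(2)[OF X L2_class_in_L2[OF partial_sum_L2[of N \<omega>]]] by (simp add: functional_partial_sum[OF l] v_def)
      also have "\<dots> \<le> (C + 1) * ?d"
        using d by (intro mult_right_mono) auto
      finally have "\<bar>l (\<Xi> \<omega>) - ?Y N \<omega>\<bar>\<^sup>2 \<le> ((C + 1) * ?d)\<^sup>2"
        by (intro power_mono) auto
      then show "ennreal ((l (\<Xi> \<omega>) - ?Y N \<omega>)\<^sup>2) \<le> 0 + ennreal ((C + 1)\<^sup>2) * ennreal (?d\<^sup>2)"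
        by (simp add: power_mult_distrib ennreal_leI flip: ennreal_mult)
    qed (use C(1) in auto)
    then show "eventually (\<lambda>N. (\<integral>\<^sup>+\<omega>. ennreal ((l (\<Xi> \<omega>) - ?Y N \<omega>)\<^sup>2) \<partial>P)
        \<le> ennreal ((C + 1)\<^sup>2) * mean_square_error N) sequentially"
      by simp
  qed simp
  then have lim: "(\<lambda>N. char (distr P borel (?Y N)) t) \<longlonglongrightarrow> char (distr P borel (\<lambda>\<omega>. l (\<Xi> \<omega>))) t" for t
    by (intro P.char_tendsto_of_L2) auto
  have "char (distr P borel (\<lambda>\<omega>. l (\<Xi> \<omega>))) t = char (density lborel (normal_density 0 \<sigma>)) t" for t
  proof (rule LIMSEQ_unique[OF lim])
    have "(\<lambda>N. \<Sum>n<N. ?a n) \<longlonglongrightarrow> \<sigma>\<^sup>2"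
      unfolding \<sigma>(2) by (rule summable_LIMSEQ[OF \<open>summable ?a\<close>])
    then have "(\<lambda>N. complex_of_real (exp (- (t\<^sup>2 * (\<Sum>n<N. ?a n) / 2))))
        \<longlonglongrightarrow> complex_of_real (exp (- (t\<^sup>2 * \<sigma>\<^sup>2 / 2)))"
      by (intro tendsto_intros) auto
    then show "(\<lambda>N. char (distr P borel (?Y N)) t) \<longlonglongrightarrow> char (density lborel (normal_density 0 \<sigma>)) t"
      by (simp add: P.char_sum_centered_normal[OF S \<xi> indep] char_density_normal[OF \<sigma>(1)] mult.commute)
  qed
  then have "distr P borel (\<lambda>\<omega>. l (\<Xi> \<omega>)) = density lborel (normal_density 0 \<sigma>)"
    by (intro Levy_uniqueness real_distribution_density_normal[OF \<sigma>(1)] P.real_distribution_distr) auto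
  moreover have "distr law lborel l = distr P borel (\<lambda>\<omega>. l (\<Xi> \<omega>))"
    by (subst distr_distr) (auto intro: distr_cong simp: comp_def)
  ultimately have "distributed law lborel l (normal_density 0 \<sigma>)"
    by (simp add: distributed_def)
  then show "\<exists>m \<sigma>. 0 < \<sigma> \<and> distributed law lborel l (normal_density m \<sigma>)"
    using \<sigma>(1) by blast
qed simp

lemma super_G_regular_G:
  assumes "alpha_integral < \<infinity>"
  shows "super_G_regular Q G"
  unfolding super_G_regular_def
proof (intro conjI ballI impI)
  fix B :: "(real^'d) measure set"
  assume B: "B \<in> sets P2_borel" and null: "gaussian_null Q {X \<in> L2 Q. iota Q X \<in> B}"
  have "emeasure G B = emeasure law (iota Q -` B \<inter> space law)"
    by (rule emeasure_distr[OF iota_law_measurable B])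
  also have "iota Q -` B \<inter> space law = {X \<in> L2 Q. iota Q X \<in> B}"
    by (auto simp: L2_borel_def)
  also have "emeasure law \<dots> = 0"
    using null nondegenerate_law by (simp add: gaussian_null_def)
  finally show "emeasure G B = 0" .
qed (fact G_in_P2P2, fact AE_G_P2r[OF assms])

end


theorem theorem6p28:
  fixes Q :: "'q measure" and P :: "'w measure"
    and E :: "nat \<Rightarrow> 'q \<Rightarrow> real"
    and S :: "nat \<Rightarrow> real^'d^'d"
    and \<alpha> \<beta> :: "nat \<Rightarrow> real"
    and \<xi> :: "nat \<Rightarrow> 'w \<Rightarrow> real^'d"
    and \<Xi> :: "'w \<Rightarrow> ('q \<Rightarrow> real^'d) set"
  assumes "CARD('d) > 1"
    and "standard_borel_space Q" and "prob_space Q" and "nonatomic Q"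
    and "complete_orthonormal_system Q E"
    and "\<And>n. sym_pos_def (S n)"
    and "\<And>n. 0 < (\<alpha> n)\<^sup>2"
    and "\<And>n v. norm v = 1 \<Longrightarrow> (\<alpha> n)\<^sup>2 \<le> (S n *v v) \<bullet> v \<and> (S n *v v) \<bullet> v \<le> (\<beta> n)\<^sup>2"
    and "summable (\<lambda>n. (\<beta> n)\<^sup>2)"
    and "prob_space P"
    and "\<And>n. centered_normal P (\<xi> n) (S n)"
    and "prob_space.indep_vars P (\<lambda>_. borel) \<xi> UNIV"
    and "L2_series_sum P Q E \<xi> \<Xi>"
    and "(\<integral>\<^sup>+ z. inverse (ennreal_sqrt (series_alpha_sq \<alpha> E (fst z) (snd z)) ^ CARD('d))
            \<partial>(Q \<Otimes>\<^sub>M Q)) < \<infinity>"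
  shows "super_G_regular Q (distr (distr P (L2_borel Q) \<Xi>) P2_borel (iota Q))"
proof -
  interpret Q: prob_space Q by fact
  interpret P: prob_space P by fact
  interpret gaussian_series Q P E S \<alpha> \<beta> \<xi> \<Xi>
    by unfold_locales (use assms in auto)
  show ?thesis
    using super_G_regular_G assms(14) by (simp add: alpha_integral_def)
qed

end
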